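(* Let $N\ge1$, $\lambda_1,\dots,\lambda_N$ distinct, $\mu_1,\dots,\mu_N$ nonzero constants, $A=\mathrm{diag}(\lambda_j)$, $B=\mathrm{diag}(\mu_j)$, and $n\ge0$. For arbitrary initial vectors $P_i(0,0),Q_i(0,0)\in\mathbb{R}^N$ ($i=1,2,3$), set $P_i(x,t_n)=g^x_Hg^{t_n}_{H_n}P_i(0,0)$, $Q_i(x,t_n)=g^x_Hg^{t_n}_{H_n}Q_i(0,0)$. Then \[q=\sqrt2(\langle P_1,BQ_2\rangle+\langle P_2,BQ_3\rangle),\qquad r=\sqrt2(\langle P_2,BQ_1\rangle+\langle P_3,BQ_2\rangle)\] (with $P_i=P_i(x,t_n)$, $Q_i=Q_i(x,t_n)$) is a solution of the $n$-th AKNS soliton equation $u_{t_n}=K_n$, $u=(q,r)^T$, and it is involutive, i.e. the phase flows $g^x_H$ and $g^{t_n}_{H_n}$ commute.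
   Context: $g^y_G$ denotes the Hamiltonian phase flow of a function $G$ on $\mathbb{R}^{6N}$ with time variable $y$, i.e. the flow of $P_{i,y}=-B^{-1}\partial G/\partial Q_i$, $Q_{i,y}=B^{-1}\partial G/\partial P_i$ ($i=1,2,3$), where $\mathbb{R}^{6N}$ has coordinates $\phi_{ij},\psi_{ij}$, $P_i=(\phi_{i1},\dots,\phi_{iN})^T$, $Q_i=(\psi_{i1},\dots,\psi_{iN})^T$, and $\langle\cdot,\cdot\rangle$ is the standard inner product on $\mathbb{R}^N$. $H=2(\langle AP_1,BQ_1\rangle-\langle AP_3,BQ_3\rangle)-2(\langle P_1,BQ_2\rangle+\langle P_2,BQ_3\rangle)(\langle P_2,BQ_1\rangle+\langle P_3,BQ_2\rangle)$. $H_n=-\frac14\sum_{m=0}^n\frac{d_m}{m+1}\sum_{i_1+\cdots+i_{m+1}=n+1,\ i_k\ge1}F_{i_1}\cdots F_{i_{m+1}}$, with $d_0=1$, $d_1=-\frac18$, $d_2=\frac3{128}$, $d_n=-\frac12\sum_{i=1}^{n-1}d_id_{n-i}-\frac14d_{n-1}-\frac18\sum_{i=1}^{n-2}d_id_{n-i-1}$ ($n\ge3$), and $F_1=-8(\langle P_1,BQ_1\rangle-\langle P_3,BQ_3\rangle)$, $F_m=4\sum_{i=1}^{m-1}\big[(\langle A^{i-1}P_1,BQ_1\rangle-\langle A^{i-1}P_3,BQ_3\rangle)(\langle A^{m-i-1}P_1,BQ_1\rangle-\langle A^{m-i-1}P_3,BQ_3\rangle)+2(\langle A^{i-1}P_1,BQ_2\rangle+\langle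 A^{i-1}P_2,BQ_3\rangle)(\langle A^{m-i-1}P_2,BQ_1\rangle+\langle A^{m-i-1}P_3,BQ_2\rangle)\big]-8(\langle A^{m-1}P_1,BQ_1\rangle-\langle A^{m-1}P_3,BQ_3\rangle)$ for $m\ge2$. AKNS hierarchy: differential polynomials $a_i,b_i,c_i$ in $q,r$ and their $x$-derivatives are defined by $a_0=-1$, $b_0=c_0=0$, and for $i\ge0$, $a_{i+1}=\frac12\partial^{-1}(q c_{i,x}+r b_{i,x})$, $b_{i+1}=-\frac12 b_{i,x}-q a_i$, $c_{i+1}=\frac12 c_{i,x}-r a_i$ ($\partial=d/dx$), constants of integration fixed by $a_i|_{u=0}=b_i|_{u=0}=c_i|_{u=0}=0$ for $i\ge1$; $K_n=(-2b_{n+1},2c_{n+1})^T$, and the $n$-th AKNS equation is $u_{t_n}=K_n$. *)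

theory Defs
  imports "HOL-Analysis.Analysis"
begin

datatype idx = I1 | I2 | I3

text \<open>A point of R^{6N}: phi i j = phi_{ij} (entries of P_i), psi i j = psi_{ij}
  (entries of Q_i); j ranges over a finite type 'n of cardinality N.\<close>
type_synonym 'n st = "(idx \<Rightarrow> 'n \<Rightarrow> real) \<times> (idx \<Rightarrow> 'n \<Rightarrow> real)"

definition Pv :: "'n st \<Rightarrow> idx \<Rightarrow> 'n \<Rightarrow> real" where "Pv z i = fst z i"
definition Qv :: "'n st \<Rightarrow> idx \<Rightarrow> 'n \<Rightarrow> real" where "Qv z i = snd z i"

definition ipAB :: "('n::finite \<Rightarrow> real) \<Rightarrow> ('n \<Rightarrow> real) \<Rightarrow> nat \<Rightarrow> ('n \<Rightarrow> real) \<Rightarrow> ('n \<Rightarrow> real) \<Rightarrow> real" where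
  "ipAB lam mu k u v = (\<Sum>j\<in>UNIV. (lam j ^ k * u j) * (mu j * v j))"

definition ee :: "('n::finite \<Rightarrow> real) \<Rightarrow> ('n \<Rightarrow> real) \<Rightarrow> nat \<Rightarrow> 'n st \<Rightarrow> real" where
  "ee lam mu k z = ipAB lam mu k (Pv z I1) (Qv z I1) - ipAB lam mu k (Pv z I3) (Qv z I3)"
definition ff :: "('n::finite \<Rightarrow> real) \<Rightarrow> ('n \<Rightarrow> real) \<Rightarrow> nat \<Rightarrow> 'n st \<Rightarrow> real" where
  "ff lam mu k z = ipAB lam mu k (Pv z I1) (Qv z I2) + ipAB lam mu k (Pv z I2) (Qv z I3)"
definition gg :: "('n::finite \<Rightarrow> real) \<Rightarrow> ('n \<Rightarrow> real) \<Rightarrow> nat \<Rightarrow> 'n st \<Rightarrow> real" where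
  "gg lam mu k z = ipAB lam mu k (Pv z I2) (Qv z I1) + ipAB lam mu k (Pv z I3) (Qv z I2)"

definition Hx :: "('n::finite \<Rightarrow> real) \<Rightarrow> ('n \<Rightarrow> real) \<Rightarrow> 'n st \<Rightarrow> real" where
  "Hx lam mu z = 2 * ee lam mu 1 z - 2 * ff lam mu 0 z * gg lam mu 0 z"

text \<open>F_m (m >= 1).\<close>
definition FF :: "('n::finite \<Rightarrow> real) \<Rightarrow> ('n \<Rightarrow> real) \<Rightarrow> nat \<Rightarrow> 'n st \<Rightarrow> real" where
  "FF lam mu m z =
     (if m = 1 then -8 * ee lam mu 0 z
      else 4 * (\<Sum>i=1..m-1. ee lam mu (i-1) z * ee lam mu (m-i-1) z
                         + 2 * ff lam mu (i-1) z * gg lam mu (m-i-1) z)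
           - 8 * ee lam mu (m-1) z)"

fun dl :: "nat \<Rightarrow> real list" where
  "dl 0 = [1]"
| "dl (Suc n) = (let L = dl n; m = Suc n in
     L @ [if m = 1 then -1/8 else if m = 2 then 3/128 else
          - 1/2 * (\<Sum>i=1..m-1. L!i * L!(m-i)) - 1/4 * L!(m-1)
          - 1/8 * (\<Sum>i=1..m-2. L!i * L!(m-i-1))])"

definition dd :: "nat \<Rightarrow> real" where "dd n = dl n ! n"

definition comps :: "nat \<Rightarrow> nat \<Rightarrow> nat list set" where
  "comps k s = {is. length is = k \<and> (\<forall>i\<in>set is. 1 \<le> i) \<and> sum_list is = s}"

definition Hn :: "('n::finite \<Rightarrow> real) \<Rightarrow> ('n \<Rightarrow> real) \<Rightarrow> nat \<Rightarrow> 'n st \<Rightarrow> real" where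
  "Hn lam mu n z = - 1/4 * (\<Sum>m=0..n. dd m / real (m+1) *
        (\<Sum>is\<in>comps (m+1) (n+1). prod_list (map (\<lambda>i. FF lam mu i z) is)))"

definition dphi :: "('n st \<Rightarrow> real) \<Rightarrow> 'n st \<Rightarrow> idx \<Rightarrow> 'n \<Rightarrow> real" where
  "dphi G z i j = deriv (\<lambda>s. G ((fst z)(i := (fst z i)(j := fst z i j + s)), snd z)) 0"
definition dpsi :: "('n st \<Rightarrow> real) \<Rightarrow> 'n st \<Rightarrow> idx \<Rightarrow> 'n \<Rightarrow> real" where
  "dpsi G z i j = deriv (\<lambda>s. G (fst z, (snd z)(i := (snd z i)(j := snd z i j + s)))) 0"

definition ham_sol :: "('n \<Rightarrow> real) \<Rightarrow> ('n st \<Rightarrow> real) \<Rightarrow> (real \<Rightarrow> 'n st) \<Rightarrow> real set \<Rightarrow> bool" where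
  "ham_sol mu G zc Y \<longleftrightarrow> (\<forall>y\<in>Y. \<forall>i j.
      ((\<lambda>s. fst (zc s) i j) has_real_derivative (- (1 / mu j) * dpsi G (zc y) i j)) (at y) \<and>
      ((\<lambda>s. snd (zc s) i j) has_real_derivative ((1 / mu j) * dphi G (zc y) i j)) (at y))"

text \<open>Differential polynomials in q, r: functions of the jet (Q k = q^{(k)}, R k = r^{(k)})
  built from constants and jet variables by sums and products.\<close>
type_synonym dpol = "(nat \<Rightarrow> real) \<Rightarrow> (nat \<Rightarrow> real) \<Rightarrow> real"

inductive dpoly :: "dpol \<Rightarrow> bool" where
  dconst: "dpoly (\<lambda>Q R. c)"
| dqvar: "dpoly (\<lambda>Q R. Q k)"
| drvar: "dpoly (\<lambda>Q R. R k)"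
| dadd: "dpoly f \<Longrightarrow> dpoly g \<Longrightarrow> dpoly (\<lambda>Q R. f Q R + g Q R)"
| dmult: "dpoly f \<Longrightarrow> dpoly g \<Longrightarrow> dpoly (\<lambda>Q R. f Q R * g Q R)"

definition Dx :: "dpol \<Rightarrow> dpol" where
  "Dx f Q R = deriv (\<lambda>s. f (\<lambda>k. Q k + s * Q (Suc k)) (\<lambda>k. R k + s * R (Suc k))) 0"

text \<open>(a,b,c) is the AKNS sequence: the recursion, with the inverse derivative
  realised as: a_{i+1} is a differential polynomial whose total derivative is the
  given one, normalised by vanishing at u = 0.\<close>
definition akns_seq :: "(nat \<Rightarrow> dpol) \<Rightarrow> (nat \<Rightarrow> dpol) \<Rightarrow> (nat \<Rightarrow> dpol) \<Rightarrow> bool" where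
  "akns_seq a b c \<longleftrightarrow>
     a 0 = (\<lambda>Q R. -1) \<and> b 0 = (\<lambda>Q R. 0) \<and> c 0 = (\<lambda>Q R. 0) \<and>
     (\<forall>i. dpoly (a i) \<and> dpoly (b i) \<and> dpoly (c i)) \<and>
     (\<forall>i. Dx (a (Suc i)) = (\<lambda>Q R. 1/2 * (Q 0 * Dx (c i) Q R + R 0 * Dx (b i) Q R)) \<and>
          b (Suc i) = (\<lambda>Q R. - 1/2 * Dx (b i) Q R - Q 0 * a i Q R) \<and>
          c (Suc i) = (\<lambda>Q R. 1/2 * Dx (c i) Q R - R 0 * a i Q R) \<and>
          a (Suc i) (\<lambda>_. 0) (\<lambda>_. 0) = 0 \<and> b (Suc i) (\<lambda>_. 0) (\<lambda>_. 0) = 0 \<and>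
          c (Suc i) (\<lambda>_. 0) (\<lambda>_. 0) = 0)"

definition xjet :: "(real \<Rightarrow> real \<Rightarrow> real) \<Rightarrow> real \<Rightarrow> real \<Rightarrow> nat \<Rightarrow> real" where
  "xjet u x t k = (deriv ^^ k) (\<lambda>y. u y t) x"

end

theory Submission
  imports Defs "HOL-Computational_Algebra.Formal_Power_Series"
begin

text \<open>
  Collect the moments into power series \<open>E, F, G\<close> in the inverse spectral parameter and put
  \<open>S\<^sup>2 = (E - 1)\<^sup>2 + 2FG\<close>.  The numbers \<open>d\<^sub>m\<close> are the coefficients of \<open>(1 + s/4)\<^bsup>-1/2\<^esup>\<close>, so
  \<open>H\<^sub>n\<close> is the coefficient of index \<open>n + 1\<close> of \<open>-2(S - 1)\<close>, and \<open>H = H\<^sub>1\<close>.  Hence the flow of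
  \<open>H\<^sub>n\<close> acts on each site linearly, through the polynomial part of the Lax matrix with entries
  \<open>\<alpha> = (E - 1)/S\<close>, \<open>\<beta> = F/S\<close>, \<open>\<gamma> = G/S\<close>.  Along the \<open>x\<close>-flow \<open>S\<close> is constant and
  \<open>\<alpha>, \<surd>2 \<beta>, \<surd>2 \<gamma>\<close> satisfy the AKNS recursion; the integration constants agree because
  both \<open>\<alpha>\<^sup>2 + 2\<beta>\<gamma>\<close> and \<open>a\<^sup>2 + bc\<close> equal 1.  Along the flow of \<open>H\<^sub>n\<close> the moments \<open>F\<^sub>0, G\<^sub>0\<close> move with
  velocity \<open>-2\<beta>\<^sub>n\<^sub>+\<^sub>1, 2\<gamma>\<^sub>n\<^sub>+\<^sub>1\<close>, which is the AKNS equation, and these two facts give the zero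
  curvature equation, i.e. the vector fields commute.  That commuting vector fields have commuting
  flows on the whole rectangle follows by Gronwall: the variational equation of the
  \<open>t\<close>-flow is solved explicitly by the \<open>x\<close>-field along the solution.
\<close>

section \<open>Commuting flows of polynomial vector fields\<close>

text \<open>The differential inequality is assumed only below the barrier \<open>\<delta>\<close>,
  because the fields to which it is applied are Lipschitz on balls only. As the Gronwall bound
  itself lies below \<open>\<delta>\<close>, there can be no first time at which the barrier is
  reached.\<close>

lemma barrier_gronwall:
  fixes u u' :: "real \<Rightarrow> real"
  assumes der: "\<And>t. t \<in> {0..\<tau>} \<Longrightarrow> (u has_real_derivative u' t) (at t)"
    and bound: "\<And>t. t \<in> {0..\<tau>} \<Longrightarrow> u t < \<delta> \<Longrightarrow> u' t \<le> L * u t + \<eta>"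
    and "0 \<le> L" "0 \<le> \<eta>" "0 \<le> u 0"
    and small: "(u 0 + \<eta> * \<tau>) * exp (L * \<tau>) < \<delta>"
    and t: "t \<in> {0..\<tau>}"
  shows "u t \<le> (u 0 + \<eta> * \<tau>) * exp (L * \<tau>)"
proof -
  have cont: "continuous_on {0..\<tau>} u"
    using der by (intro DERIV_atLeastAtMost_imp_continuous_on) auto
  have est: "u s \<le> (u 0 + \<eta> * \<tau>) * exp (L * \<tau>)"
    if s: "s \<in> {0..\<tau>}" and below: "\<And>r. 0 < r \<Longrightarrow> r < s \<Longrightarrow> u r < \<delta>" for s
  proof -
    \<comment> \<open>Integrating factor: the assumed inequality makes \<open>w\<close>
      nonincreasing.\<close>
    define w where "w r = exp (- (L * r)) * u r - \<eta> * r" for r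
    have "w s \<le> w 0"
    proof (cases "s = 0")
      case False
      show ?thesis
      proof (rule DERIV_nonpos_imp_decreasing_open[of 0 s])
        show "0 \<le> s" using s by auto
        show "\<exists>y. DERIV w r :> y \<and> y \<le> 0" if "0 < r" "r < s" for r
        proof -
          have r: "r \<in> {0..\<tau>}" using that s by auto
          have d: "DERIV w r :> exp (- (L * r)) * (u' r - L * u r) - \<eta>"
            unfolding w_def
            by (rule derivative_eq_intros der[OF r] refl | simp add: algebra_simps)+
          have "exp (- (L * r)) * (u' r - L * u r) \<le> exp (- (L * r)) * \<eta>"
            using bound[OF r below[OF that]] by (intro mult_left_mono) auto
          also have "\<dots> \<le> 1 * \<eta>"
            using that \<open>0 \<le> L\<close> \<open>0 \<le> \<eta>\<close> by (intro mult_right_mono) auto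
          finally show ?thesis using d by (intro exI[of _ "exp (- (L * r)) * (u' r - L * u r) - \<eta>"]) simp
        qed
        show "continuous_on {0..s} w" unfolding w_def
          using s by (intro continuous_intros continuous_on_subset[OF cont]) auto
      qed
    qed simp
    then have "exp (- (L * s)) * u s \<le> u 0 + \<eta> * s" by (simp add: w_def)
    then have "exp (L * s) * (exp (- (L * s)) * u s) \<le> exp (L * s) * (u 0 + \<eta> * s)"
      by (intro mult_left_mono) auto
    moreover have "exp (L * s) * (exp (- (L * s)) * u s) = u s"
      by (simp add: exp_minus)
    moreover have "exp (L * s) * (u 0 + \<eta> * s) \<le> exp (L * \<tau>) * (u 0 + \<eta> * \<tau>)"
      using s assms(3-5) by (intro mult_mono add_mono) (auto simp: mult_left_mono)
    ultimately show ?thesis by (metis mult.commute order.trans)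
  qed
  have "u r < \<delta>" if r: "r \<in> {0..\<tau>}" for r
  proof (rule ccontr)
    assume "\<not> u r < \<delta>"
    \<comment> \<open>By compactness there is a first time at or above the barrier;
      \<open>est\<close> still applies to it and contradicts \<open>small\<close>.\<close>
    define S where "S = {0..\<tau>} \<inter> u -` {\<delta>..}"
    have "S \<noteq> {}" using \<open>\<not> u r < \<delta>\<close> r by (auto simp: S_def)
    have "closed S" unfolding S_def
      by (intro continuous_closed_preimage cont) auto
    then have "compact S"
      by (simp add: S_def compact_eq_bounded_closed bounded_Int)
    then obtain s where s: "s \<in> S" "\<And>r. r \<in> S \<Longrightarrow> s \<le> r"
      using compact_attains_inf[of S] \<open>S \<noteq> {}\<close> by auto
    have "u s \<le> (u 0 + \<eta> * \<tau>) * exp (L * \<tau>)"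
    proof (rule est)
      show "s \<in> {0..\<tau>}" using s by (auto simp: S_def)
      show "u r < \<delta>" if "0 < r" "r < s" for r
        using s(2)[of r] that s(1) by (force simp: S_def)
    qed
    then show False using s(1) small by (auto simp: S_def)
  qed
  then show ?thesis using t by (intro est) auto
qed

section \<open>Continuous differentiability of polynomial maps and uniform estimates on
  balls\<close>

lemma real_polynomial_function_C1:
  fixes p :: "'a::real_normed_vector \<Rightarrow> real"
  assumes "real_polynomial_function p"
  obtains p' :: "'a \<Rightarrow> 'a \<Rightarrow>\<^sub>L real"
  where "\<And>z. (p has_derivative blinfun_apply (p' z)) (at z)" "continuous_on UNIV p'"
proof -
  from assms have "\<exists>p' :: 'a \<Rightarrow> 'a \<Rightarrow>\<^sub>L real.
      (\<forall>z. (p has_derivative blinfun_apply (p' z)) (at z)) \<and> continuous_on UNIV p'"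
  proof (induction p rule: real_polynomial_function.induct)
    case (linear f)
    then show ?case
      by (intro exI[of _ "\<lambda>_. Blinfun f"])
        (auto simp: bounded_linear_Blinfun_apply bounded_linear_imp_has_derivative)
  next
    case (const c)
    then show ?case by (intro exI[of _ "\<lambda>_. 0"]) (auto intro!: derivative_eq_intros)
  next
    case (add f g)
    then obtain f' g' where
      "\<And>z. (f has_derivative blinfun_apply (f' z)) (at z)" "continuous_on UNIV f'"
      "\<And>z. (g has_derivative blinfun_apply (g' z)) (at z)" "continuous_on UNIV g'"
      by blast
    then show ?case
      by (intro exI[of _ "\<lambda>z. f' z + g' z"])
        (auto intro!: derivative_eq_intros continuous_intros simp: blinfun.add_left)
  next
    case (mult f g)
    then obtain f' g' where *:
      "\<And>z. (f has_derivative blinfun_apply (f' z)) (at z)" "continuous_on UNIV f'"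
      "\<And>z. (g has_derivative blinfun_apply (g' z)) (at z)" "continuous_on UNIV g'"
      by blast
    have "continuous_on UNIV f" "continuous_on UNIV g"
      using * by (auto simp: continuous_on_eq_continuous_at intro: has_derivative_continuous)
    with * show ?case
      by (intro exI[of _ "\<lambda>z. f z *\<^sub>R g' z + g z *\<^sub>R f' z"])
        (auto intro!: derivative_eq_intros continuous_intros
          simp: blinfun.add_left blinfun.scaleR_left)
  qed
  then show thesis using that by blast
qed

lemma polynomial_function_C1:
  fixes g :: "'a::real_normed_vector \<Rightarrow> 'b::euclidean_space"
  assumes "polynomial_function g"
  obtains g' :: "'a \<Rightarrow> 'a \<Rightarrow>\<^sub>L 'b"
  where "\<And>z. (g has_derivative blinfun_apply (g' z)) (at z)" "continuous_on UNIV g'"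
proof -
  have "\<exists>p' :: 'a \<Rightarrow> 'a \<Rightarrow>\<^sub>L real.
      (\<forall>z. ((\<lambda>z. g z \<bullet> b) has_derivative blinfun_apply (p' z)) (at z)) \<and> continuous_on UNIV p'"
    if "b \<in> Basis" for b
    using assms that real_polynomial_function_C1 unfolding polynomial_function_iff_Basis_inner
    by metis
  then obtain p' :: "'b \<Rightarrow> 'a \<Rightarrow> 'a \<Rightarrow>\<^sub>L real" where
    p': "\<And>b z. b \<in> Basis \<Longrightarrow> ((\<lambda>z. g z \<bullet> b) has_derivative blinfun_apply (p' b z)) (at z)"
      "\<And>b. b \<in> Basis \<Longrightarrow> continuous_on UNIV (p' b)"
    by metis
  define g' where "g' z = (\<Sum>b\<in>Basis. blinfun_scaleR_left b o\<^sub>L p' b z)" for z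
  show thesis
  proof
    fix z
    have "((\<lambda>z. \<Sum>b\<in>Basis. (g z \<bullet> b) *\<^sub>R b) has_derivative blinfun_apply (g' z)) (at z)"
      by (rule derivative_eq_intros p' refl | assumption)+
        (simp add: fun_eq_iff g'_def blinfun.sum_left)
    then show "(g has_derivative blinfun_apply (g' z)) (at z)"
      by (simp add: euclidean_representation)
  next
    show "continuous_on UNIV g'"
      unfolding g'_def by (intro continuous_intros p')
  qed
qed

text \<open>Compactness of the ball bounds the derivative, and its convexity turns this into a
  Lipschitz constant. Uniform continuity of the derivative makes the first-order Taylor remainder
  small uniformly in the base point.\<close>

lemma C1_uniform_estimates:
  fixes g :: "'a::euclidean_space \<Rightarrow> 'b::euclidean_space"
  assumes g': "\<And>z. (g has_derivative blinfun_apply (g' z)) (at z)" "continuous_on UNIV g'"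
  obtains L where "0 \<le> L" "\<And>z. z \<in> cball 0 R \<Longrightarrow> norm (g' z) \<le> L"
    "\<And>a b. a \<in> cball 0 R \<Longrightarrow> b \<in> cball 0 R \<Longrightarrow> norm (g b - g a) \<le> L * norm (b - a)"
    "\<And>\<epsilon>. 0 < \<epsilon> \<Longrightarrow> \<exists>\<delta>>0. \<forall>a\<in>cball 0 R. \<forall>b\<in>cball 0 R. norm (b - a) < \<delta> \<longrightarrow>
       norm (g b - g a - g' a (b - a)) \<le> \<epsilon> * norm (b - a)"
proof -
  have c: "continuous_on (cball 0 R) g'" using g'(2) continuous_on_subset by blast
  then have "bounded (g' ` cball 0 R)"
    by (intro compact_imp_bounded compact_continuous_image) auto
  then obtain L0 where L0: "\<And>z. z \<in> cball 0 R \<Longrightarrow> norm (g' z) \<le> L0"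
    unfolding bounded_iff by blast
  define L where "L = max L0 0"
  have L: "norm (g' z) \<le> L" if "z \<in> cball 0 R" for z using L0[OF that] by (auto simp: L_def)
  show thesis
  proof
    show "0 \<le> L" by (simp add: L_def)
    show "norm (g' z) \<le> L" if "z \<in> cball 0 R" for z using L that .
    show "norm (g b - g a) \<le> L * norm (b - a)" if "a \<in> cball 0 R" "b \<in> cball 0 R" for a b
      by (rule differentiable_bound[where S="cball 0 R" and f'="\<lambda>z. blinfun_apply (g' z)"])
        (use that L in \<open>auto intro: has_derivative_at_withinI g' simp flip: norm_blinfun.rep_eq\<close>)
    show "\<exists>\<delta>>0. \<forall>a\<in>cball 0 R. \<forall>b\<in>cball 0 R. norm (b - a) < \<delta> \<longrightarrow>
       norm (g b - g a - g' a (b - a)) \<le> \<epsilon> * norm (b - a)" if "0 < \<epsilon>" for \<epsilon>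
    proof -
      have "uniformly_continuous_on (cball 0 R) g'"
        using c by (intro compact_uniformly_continuous) auto
      then obtain \<delta> where \<delta>: "\<delta> > 0"
        "\<And>a z. a \<in> cball 0 R \<Longrightarrow> z \<in> cball 0 R \<Longrightarrow> dist z a < \<delta> \<Longrightarrow> dist (g' z) (g' a) < \<epsilon>"
        using \<open>0 < \<epsilon>\<close> unfolding uniformly_continuous_on_def by metis
      have "norm (g b - g a - g' a (b - a)) \<le> \<epsilon> * norm (b - a)"
        if ab: "a \<in> cball 0 R" "b \<in> cball 0 R" "norm (b - a) < \<delta>" for a b
      proof -
        \<comment> \<open>The mean value inequality is applied to \<open>g\<close> minus its linear
          part at \<open>a\<close>, whose derivative is at most \<open>\<epsilon>\<close> close to
          \<open>a\<close>.\<close>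
        have "norm ((g b - g' a b) - (g a - g' a a)) \<le> \<epsilon> * norm (b - a)"
        proof (rule differentiable_bound[where S="cball 0 R \<inter> ball a \<delta>"
                and f'="\<lambda>z. blinfun_apply (g' z - g' a)"])
          show "((\<lambda>x. g x - g' a x) has_derivative blinfun_apply (g' x - g' a))
              (at x within cball 0 R \<inter> ball a \<delta>)" for x
            by (auto intro!: derivative_eq_intros has_derivative_at_withinI[OF g'(1)]
                simp: blinfun.diff_left)
          show "onorm (blinfun_apply (g' x - g' a)) \<le> \<epsilon>" if "x \<in> cball 0 R \<inter> ball a \<delta>" for x
            using \<delta>(2)[of a x] that ab
            by (auto simp: dist_norm norm_minus_commute simp flip: norm_blinfun.rep_eq)
        qed (use ab \<delta> in \<open>auto simp: dist_norm norm_minus_commute intro: convex_Int\<close>)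
        then show ?thesis by (simp add: blinfun.diff_right algebra_simps)
      qed
      with \<delta>(1) show ?thesis by blast
    qed
  qed
qed

lemma has_real_derivative_norm_square:
  fixes y :: "real \<Rightarrow> 'a::real_inner"
  assumes "(y has_vector_derivative v) (at t)"
  shows "((\<lambda>s. (norm (y s))\<^sup>2) has_real_derivative 2 * (y t \<bullet> v)) (at t)"
  unfolding power2_norm_eq_inner has_field_derivative_def
  using assms unfolding has_vector_derivative_def
  by (auto intro!: derivative_eq_intros simp: inner_commute algebra_simps)

text \<open>Gronwall for the squared distance, which is differentiable even where the solutions
  meet. The barrier 1 keeps \<open>y2\<close> in the ball of radius \<open>R\<close>, where the
  Lipschitz bound holds, because \<open>y1\<close> stays in the ball of radius
  \<open>R - 1\<close>.\<close>

lemma flow_continuous_dependence: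
  fixes g :: "'a::euclidean_space \<Rightarrow> 'a" and y1 y2 :: "real \<Rightarrow> 'a"
  assumes L: "0 \<le> L"
      "\<And>a b. a \<in> cball 0 R \<Longrightarrow> b \<in> cball 0 R \<Longrightarrow> norm (g b - g a) \<le> L * norm (b - a)"
    and y1: "\<And>t. t \<in> {0..\<tau>} \<Longrightarrow> (y1 has_vector_derivative g (y1 t)) (at t)"
    and y2: "\<And>t. t \<in> {0..\<tau>} \<Longrightarrow> (y2 has_vector_derivative g (y2 t)) (at t)"
    and R: "\<And>t. t \<in> {0..\<tau>} \<Longrightarrow> norm (y1 t) \<le> R - 1"
    and small: "(norm (y2 0 - y1 0))\<^sup>2 * exp (2 * L * \<tau>) < 1"
    and t: "t \<in> {0..\<tau>}"
  shows "(norm (y2 t - y1 t))\<^sup>2 \<le> (norm (y2 0 - y1 0))\<^sup>2 * exp (2 * L * \<tau>)"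
proof -
  define D where "D t = y2 t - y1 t" for t
  have D: "(D has_vector_derivative g (y2 t) - g (y1 t)) (at t)" if "t \<in> {0..\<tau>}" for t
    unfolding D_def by (intro has_vector_derivative_diff y1 y2 that)
  have "(norm (D t))\<^sup>2 \<le> ((norm (D 0))\<^sup>2 + 0 * \<tau>) * exp (2 * L * \<tau>)"
  proof (rule barrier_gronwall[where u="\<lambda>t. (norm (D t))\<^sup>2" and u'="\<lambda>t. 2 * (D t \<bullet> (g (y2 t) - g (y1 t)))" and \<delta>=1])
    show "((\<lambda>t. (norm (D t))\<^sup>2) has_real_derivative 2 * (D t \<bullet> (g (y2 t) - g (y1 t)))) (at t)"
      if "t \<in> {0..\<tau>}" for t
      by (intro has_real_derivative_norm_square D that)
    show "2 * (D t \<bullet> (g (y2 t) - g (y1 t))) \<le> 2 * L * (norm (D t))\<^sup>2 + 0"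
      if t: "t \<in> {0..\<tau>}" and lt: "(norm (D t))\<^sup>2 < 1" for t
    proof -
      have "norm (D t) < 1" using lt by (simp add: power_less_one_iff)
      moreover have "norm (y2 t) \<le> norm (D t) + norm (y1 t)"
        unfolding D_def by norm
      ultimately have "norm (g (y2 t) - g (y1 t)) \<le> L * norm (D t)"
        unfolding D_def using R[OF t] by (intro L) auto
      then have "norm (D t) * norm (g (y2 t) - g (y1 t)) \<le> norm (D t) * (L * norm (D t))"
        by (intro mult_left_mono) auto
      then show ?thesis
        using norm_cauchy_schwarz[of "D t" "g (y2 t) - g (y1 t)"]
        by (simp add: power2_eq_square algebra_simps)
    qed
  qed (use L t small in \<open>auto simp: D_def\<close>)
  then show ?thesis by (simp add: D_def)
qed

lemma flow_bounded:
  fixes y :: "real \<Rightarrow> 'a::euclidean_space"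
  assumes "\<And>t. t \<in> {0..\<tau>} \<Longrightarrow> (y has_vector_derivative g (y t)) (at t)"
  obtains R where "\<And>t. t \<in> {0..\<tau>} \<Longrightarrow> norm (y t) \<le> R - 1"
proof -
  have "continuous_on {0..\<tau>} y"
    using assms by (meson continuous_at_imp_continuous_on has_vector_derivative_continuous)
  then have "bounded (y ` {0..\<tau>})"
    by (intro compact_imp_bounded compact_continuous_image) auto
  then obtain B where "\<And>t. t \<in> {0..\<tau>} \<Longrightarrow> norm (y t) \<le> B" unfolding bounded_iff by blast
  then show thesis by (intro that[of "B + 1"]) auto
qed

lemma flow_unique_nonneg:
  fixes g :: "'a::euclidean_space \<Rightarrow> 'a"
  assumes "polynomial_function g" "0 \<le> \<tau>"
    and y1: "\<And>t. t \<in> {0..\<tau>} \<Longrightarrow> (y1 has_vector_derivative g (y1 t)) (at t)"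
    and y2: "\<And>t. t \<in> {0..\<tau>} \<Longrightarrow> (y2 has_vector_derivative g (y2 t)) (at t)"
    and init: "y1 0 = y2 0"
  shows "y1 \<tau> = y2 \<tau>"
proof -
  obtain g' where g': "\<And>z. (g has_derivative blinfun_apply (g' z)) (at z)" "continuous_on UNIV g'"
    using polynomial_function_C1 assms(1) by blast
  obtain R where R: "\<And>t. t \<in> {0..\<tau>} \<Longrightarrow> norm (y1 t) \<le> R - 1"
    using flow_bounded[of \<tau> y1 g] y1 by blast
  obtain L where L: "0 \<le> L"
      "\<And>a b. a \<in> cball 0 R \<Longrightarrow> b \<in> cball 0 R \<Longrightarrow> norm (g b - g a) \<le> L * norm (b - a)"
    using C1_uniform_estimates[OF g', where R=R] by metis
  have "(norm (y2 \<tau> - y1 \<tau>))\<^sup>2 \<le> (norm (y2 0 - y1 0))\<^sup>2 * exp (2 * L * \<tau>)"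
    by (rule flow_continuous_dependence[OF L y1 y2 R]) (use init assms(2) in auto)
  then show ?thesis using init by simp
qed

text \<open>By \<open>var\<close>, \<open>f (W x t)\<close> solves the variational equation of the
  \<open>t\<close>-flow, with the initial value of the \<open>x\<close>-derivative of
  \<open>W\<close>. Hence the error of the linear approximation in \<open>x\<close> with slope
  \<open>f (W x t)\<close>, being of smaller order at time 0, stays so by Gronwall.\<close>

lemma flow_parameter_derivative:
  fixes f g :: "'a::euclidean_space \<Rightarrow> 'a" and W :: "real \<Rightarrow> real \<Rightarrow> 'a"
  assumes g': "\<And>z. (g has_derivative blinfun_apply (g' z)) (at z)" "continuous_on UNIV g'"
    and X: "open X" "x \<in> X" and \<tau>: "0 \<le> \<tau>"
    and Wt: "\<And>x t. x \<in> X \<Longrightarrow> t \<in> {0..\<tau>} \<Longrightarrow> (W x has_vector_derivative g (W x t)) (at t)"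
    and Wx: "((\<lambda>x. W x 0) has_vector_derivative f (W x 0)) (at x)"
    and var: "\<And>t. t \<in> {0..\<tau>} \<Longrightarrow>
       ((\<lambda>t. f (W x t)) has_vector_derivative g' (W x t) (f (W x t))) (at t)"
  shows "((\<lambda>x. W x \<tau>) has_vector_derivative f (W x \<tau>)) (at x)"
proof -
  obtain R where R: "\<And>t. t \<in> {0..\<tau>} \<Longrightarrow> norm (W x t) \<le> R - 1"
    using flow_bounded[of \<tau> "W x" g] Wt X by blast
  obtain L where L: "0 \<le> L" "\<And>z. z \<in> cball 0 R \<Longrightarrow> norm (g' z) \<le> L"
      "\<And>a b. a \<in> cball 0 R \<Longrightarrow> b \<in> cball 0 R \<Longrightarrow> norm (g b - g a) \<le> L * norm (b - a)"
    and taylor: "\<And>\<epsilon>. 0 < \<epsilon> \<Longrightarrow> \<exists>\<delta>>0. \<forall>a\<in>cball 0 R. \<forall>b\<in>cball 0 R. norm (b - a) < \<delta> \<longrightarrow>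
       norm (g b - g a - g' a (b - a)) \<le> \<epsilon> * norm (b - a)"
    using C1_uniform_estimates[OF g', where R=R] by metis
  define K where "K = exp (2 * L * \<tau>)"
  define M where "M = norm (f (W x 0)) + 1"
  \<comment> \<open>\<open>M\<close> bounds the initial difference quotient and \<open>K\<close> its
    squared growth. \<open>Q\<close> is the total factor in the final bound for the squared error,
    so that the choice \<open>e / sqrt Q\<close> below yields exactly \<open>e\<close>.\<close>
  define Q where "Q = exp ((2 * L + 1) * \<tau>) * (1 + \<tau> * M\<^sup>2 * K)"
  have "K > 0" "M > 0" by (auto simp: K_def M_def add_nonneg_pos)
  have "Q > 0" unfolding Q_def using \<tau> \<open>K > 0\<close> by (intro mult_pos_pos add_pos_nonneg) auto
  from Wx have Wx': "\<And>e. 0 < e \<Longrightarrow> \<exists>d>0. \<forall>y. norm (y - x) < d \<longrightarrow>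
      norm (W y 0 - W x 0 - (y - x) *\<^sub>R f (W x 0)) \<le> e * norm (y - x)"
    unfolding has_vector_derivative_def has_derivative_at_alt by auto
  obtain d1 where d1: "d1 > 0" "\<And>y. norm (y - x) < d1 \<Longrightarrow>
      norm (W y 0 - W x 0 - (y - x) *\<^sub>R f (W x 0)) \<le> 1 * norm (y - x)"
    using Wx'[of 1] by auto
  obtain d3 where d3: "d3 > 0" "\<And>y. norm (y - x) < d3 \<Longrightarrow> y \<in> X"
    using X by (auto simp: open_dist dist_norm)
  have "\<exists>d>0. \<forall>y. norm (y - x) < d \<longrightarrow>
      norm (W y \<tau> - W x \<tau> - (y - x) *\<^sub>R f (W x \<tau>)) \<le> e * norm (y - x)" if "e > 0" for e
  proof -
    define \<epsilon> where "\<epsilon> = e / sqrt Q"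
    have "\<epsilon> > 0" using \<open>e > 0\<close> \<open>Q > 0\<close> by (simp add: \<epsilon>_def)
    have \<epsilon>Q: "\<epsilon>\<^sup>2 * Q = e\<^sup>2" using \<open>Q > 0\<close> by (simp add: \<epsilon>_def power_divide)
    obtain \<delta> where \<delta>: "\<delta> > 0" "\<And>a b. a \<in> cball 0 R \<Longrightarrow> b \<in> cball 0 R \<Longrightarrow> norm (b - a) < \<delta> \<Longrightarrow>
       norm (g b - g a - g' a (b - a)) \<le> \<epsilon> * norm (b - a)"
      using taylor[OF \<open>\<epsilon> > 0\<close>] by blast
    obtain d2 where d2: "d2 > 0" "\<And>y. norm (y - x) < d2 \<Longrightarrow>
      norm (W y 0 - W x 0 - (y - x) *\<^sub>R f (W x 0)) \<le> \<epsilon> * norm (y - x)"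
      using Wx'[OF \<open>\<epsilon> > 0\<close>] by auto
    \<comment> \<open>Distances below \<open>\<rho>\<close> keep the neighbouring solution both in
      the ball of radius \<open>R\<close> and within the range of the Taylor estimate;
      \<open>d4\<close> ensures this on the whole time interval.\<close>
    define \<rho> where "\<rho> = min 1 \<delta>"
    define d4 where "d4 = \<rho> / (M * sqrt K)"
    have "\<rho> > 0" "d4 > 0" using \<delta>(1) \<open>M > 0\<close> \<open>K > 0\<close> by (auto simp: \<rho>_def d4_def)
    define d where "d = min (min d1 d2) (min d3 d4)"
    have "norm (W y \<tau> - W x \<tau> - (y - x) *\<^sub>R f (W x \<tau>)) \<le> e * norm (y - x)"
      if y: "norm (y - x) < d" for y
    proof -
      define h where "h = y - x"
      have h: "norm h < d1" "norm h < d2" "norm h < d3" "norm h < d4"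
        using y by (auto simp: d_def h_def)
      have "y \<in> X" using d3 h by (auto simp: h_def)
      have "norm (W y 0 - W x 0) \<le> norm (W y 0 - W x 0 - h *\<^sub>R f (W x 0)) + norm (h *\<^sub>R f (W x 0))"
        by (metis diff_add_cancel norm_triangle_ineq)
      also have "\<dots> \<le> norm h + norm h * norm (f (W x 0))"
        using d1(2)[of y] h by (auto simp: h_def)
      finally have D0: "norm (W y 0 - W x 0) \<le> M * norm h" by (simp add: M_def algebra_simps)
      have D0K: "(norm (W y 0 - W x 0))\<^sup>2 * K \<le> M\<^sup>2 * h\<^sup>2 * K"
        using power_mono[OF D0, of 2] \<open>K > 0\<close> by (simp add: power_mult_distrib)
      have "M * sqrt K * norm h < \<rho>"
        using h(4) \<open>M > 0\<close> \<open>K > 0\<close> by (simp add: d4_def field_simps)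
      then have "(M * sqrt K * norm h)\<^sup>2 < \<rho>\<^sup>2"
        using \<open>M > 0\<close> \<open>K > 0\<close> by (intro power_strict_mono) auto
      then have small: "M\<^sup>2 * h\<^sup>2 * K < \<rho>\<^sup>2"
        using \<open>K > 0\<close> by (simp add: power_mult_distrib mult_ac)
      have "\<rho>\<^sup>2 \<le> 1" using \<open>\<rho> > 0\<close> by (simp add: \<rho>_def power_le_one)
      have small0: "(norm (W y 0 - W x 0))\<^sup>2 * exp (2 * L * \<tau>) < 1"
        using D0K small \<open>\<rho>\<^sup>2 \<le> 1\<close> unfolding K_def by linarith
      have Dt: "(norm (W y t - W x t))\<^sup>2 \<le> M\<^sup>2 * h\<^sup>2 * K" if "t \<in> {0..\<tau>}" for t
      proof -
        have "(norm (W y t - W x t))\<^sup>2 \<le> (norm (W y 0 - W x 0))\<^sup>2 * exp (2 * L * \<tau>)"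
          by (rule flow_continuous_dependence[OF L(1,3) Wt[OF X(2)] Wt[OF \<open>y \<in> X\<close>] R small0 that])
        then show ?thesis using D0K unfolding K_def by linarith
      qed
      have Dt\<rho>: "norm (W y t - W x t) < \<rho>" if "t \<in> {0..\<tau>}" for t
      proof (rule power_less_imp_less_base)
        show "(norm (W y t - W x t))\<^sup>2 < \<rho>\<^sup>2" using Dt[OF that] small by linarith
      qed (use \<open>\<rho> > 0\<close> in auto)
      define e' where "e' t = W y t - W x t - h *\<^sub>R f (W x t)" for t
      define v where "v t = g (W y t) - g (W x t) - h *\<^sub>R g' (W x t) (f (W x t))" for t
      define \<eta> where "\<eta> = \<epsilon>\<^sup>2 * (M\<^sup>2 * h\<^sup>2 * K)"
      have "\<eta> \<ge> 0" using \<open>K > 0\<close> by (simp add: \<eta>_def)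
      have e': "(e' has_vector_derivative v t) (at t)" if "t \<in> {0..\<tau>}" for t
        unfolding e'_def v_def using var[OF that] Wt[OF X(2) that] Wt[OF \<open>y \<in> X\<close> that]
        by (auto intro!: derivative_eq_intros)
      have "(norm (e' \<tau>))\<^sup>2 \<le> ((norm (e' 0))\<^sup>2 + \<eta> * \<tau>) * exp ((2 * L + 1) * \<tau>)"
      \<comment> \<open>The barrier is put above the claimed bound: here the inequality holds on the
        whole interval, thanks to \<open>Dt\<rho>\<close>.\<close>
      proof (rule barrier_gronwall[where u="\<lambda>t. (norm (e' t))\<^sup>2" and u'="\<lambda>t. 2 * (e' t \<bullet> v t)"
              and \<delta>="((norm (e' 0))\<^sup>2 + \<eta> * \<tau>) * exp ((2 * L + 1) * \<tau>) + 1"])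
        show "((\<lambda>t. (norm (e' t))\<^sup>2) has_real_derivative 2 * (e' t \<bullet> v t)) (at t)"
          if "t \<in> {0..\<tau>}" for t
          by (intro has_real_derivative_norm_square e' that)
        show "2 * (e' t \<bullet> v t) \<le> (2 * L + 1) * (norm (e' t))\<^sup>2 + \<eta>" if t: "t \<in> {0..\<tau>}" for t
        proof -
          define D where "D = W y t - W x t"
          define rem where "rem = g (W y t) - g (W x t) - g' (W x t) D"
          have "norm D < \<rho>" using Dt\<rho>[OF t] by (simp add: D_def)
          then have "norm D < 1" "norm D < \<delta>" by (auto simp: \<rho>_def)
          have wx: "W x t \<in> cball 0 R" using R[OF t] by simp
          have "norm (W y t) \<le> norm D + norm (W x t)" unfolding D_def by norm
          then have wy: "W y t \<in> cball 0 R" using R[OF t] \<open>norm D < 1\<close> by simp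
          have "norm rem \<le> \<epsilon> * norm D"
            using \<delta>(2)[OF wx wy] \<open>norm D < \<delta>\<close> by (simp add: rem_def D_def)
          then have "(norm rem)\<^sup>2 \<le> \<epsilon>\<^sup>2 * (norm D)\<^sup>2"
            using power_mono[of "norm rem" "\<epsilon> * norm D" 2] by (simp add: power_mult_distrib)
          also have "\<dots> \<le> \<eta>"
            unfolding \<eta>_def D_def using Dt[OF t] by (intro mult_left_mono) auto
          finally have rem: "(norm rem)\<^sup>2 \<le> \<eta>" .
          have v: "v t = g' (W x t) (e' t) + rem"
            by (simp add: v_def rem_def e'_def D_def blinfun.diff_right blinfun.scaleR_right)
          have "e' t \<bullet> g' (W x t) (e' t) \<le> norm (e' t) * norm (g' (W x t) (e' t))"
            by (rule norm_cauchy_schwarz)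
          also have "\<dots> \<le> norm (e' t) * (L * norm (e' t))"
            by (intro mult_left_mono order.trans[OF norm_blinfun] mult_right_mono L wx) auto
          finally have 1: "e' t \<bullet> g' (W x t) (e' t) \<le> L * (norm (e' t))\<^sup>2"
            by (simp add: power2_eq_square algebra_simps)
          \<comment> \<open>Young's inequality separates the remainder; it is the source of the 1 in
            the rate \<open>2 * L + 1\<close>.\<close>
          have "0 \<le> (norm (e' t) - norm rem)\<^sup>2" by simp
          then have "2 * (norm (e' t) * norm rem) \<le> (norm (e' t))\<^sup>2 + (norm rem)\<^sup>2"
            by (simp add: power2_eq_square algebra_simps)
          then have 2: "2 * (e' t \<bullet> rem) \<le> (norm (e' t))\<^sup>2 + \<eta>"
            using norm_cauchy_schwarz[of "e' t" rem] rem by linarith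
          show ?thesis using 1 2 by (simp add: v inner_add_right algebra_simps)
        qed
      qed (use L(1) \<tau> \<open>\<eta> \<ge> 0\<close> in auto)
      moreover have "(norm (e' 0))\<^sup>2 \<le> \<epsilon>\<^sup>2 * h\<^sup>2"
        using power_mono[OF d2(2)[of y], of 2] h by (simp add: e'_def h_def power_mult_distrib)
      then have "((norm (e' 0))\<^sup>2 + \<eta> * \<tau>) * exp ((2 * L + 1) * \<tau>)
          \<le> (\<epsilon>\<^sup>2 * h\<^sup>2 + \<eta> * \<tau>) * exp ((2 * L + 1) * \<tau>)"
        by (intro mult_right_mono add_right_mono) auto
      moreover have "(\<epsilon>\<^sup>2 * h\<^sup>2 + \<eta> * \<tau>) * exp ((2 * L + 1) * \<tau>) = (\<epsilon>\<^sup>2 * Q) * h\<^sup>2"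
        by (simp add: \<eta>_def Q_def algebra_simps)
      ultimately have "(norm (e' \<tau>))\<^sup>2 \<le> (e * norm h)\<^sup>2"
        by (simp add: \<epsilon>Q power_mult_distrib)
      then have "norm (e' \<tau>) \<le> e * norm h"
        by (rule power2_le_imp_le) (use \<open>e > 0\<close> in auto)
      then show ?thesis by (simp add: e'_def h_def)
    qed
    moreover have "d > 0" using d1 d2 d3 \<open>d4 > 0\<close> by (simp add: d_def)
    ultimately show ?thesis by blast
  qed
  then show ?thesis
    unfolding has_vector_derivative_def has_derivative_at_alt
    by (auto intro: bounded_linear_scaleR_left)
qed


lemma connected_contains_Icc_0:
  fixes T :: "real set"
  assumes "connected T" "0 \<in> T" "\<tau> \<in> T"
  shows "{0..\<tau>} \<subseteq> T"
  using assms connected_contains_Icc by blast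

lemma has_vector_derivative_reflect:
  assumes "(y has_vector_derivative v) (at (- t))"
  shows "((\<lambda>t. y (- t)) has_vector_derivative - v) (at t)"
proof -
  have "(uminus has_vector_derivative - 1) (at t)"
    by (auto intro!: derivative_eq_intros)
  from vector_diff_chain_at[OF this assms] show ?thesis by (simp add: o_def)
qed

lemma connected_reflect:
  fixes T :: "real set"
  shows "connected T \<Longrightarrow> connected (uminus ` T)"
  by (intro connected_continuous_image continuous_intros)

lemma flow_unique:
  fixes g :: "'a::euclidean_space \<Rightarrow> 'a"
  assumes g: "polynomial_function g" and T: "connected T" "0 \<in> T" "\<tau> \<in> T"
    and y1: "\<And>t. t \<in> T \<Longrightarrow> (y1 has_vector_derivative g (y1 t)) (at t)"
    and y2: "\<And>t. t \<in> T \<Longrightarrow> (y2 has_vector_derivative g (y2 t)) (at t)"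
    and init: "y1 0 = y2 0"
  shows "y1 \<tau> = y2 \<tau>"
proof (cases "0 \<le> \<tau>")
  case True
  then show ?thesis
    using connected_contains_Icc_0[OF T]
    by (intro flow_unique_nonneg[OF g True y1 y2 init]) auto
next
  case False
  have sub: "{0..-\<tau>} \<subseteq> uminus ` T"
    by (intro connected_contains_Icc_0 connected_reflect) (use T in auto)
  have "(\<lambda>t. y1 (- t)) (- \<tau>) = (\<lambda>t. y2 (- t)) (- \<tau>)"
    by (rule flow_unique_nonneg[where g="\<lambda>z. - g z"])
      (use g False init sub in \<open>auto intro!: has_vector_derivative_reflect y1 y2\<close>)
  then show ?thesis by simp
qed

text \<open>\<open>bracket\<close> says that the derivative of \<open>f\<close> in direction
  \<open>g\<close> equals that of \<open>g\<close> in direction \<open>f\<close>, i.e. the Lie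
  bracket vanishes. For \<open>W\<close> the \<open>x\<close>-equation is given at
  \<open>t = 0\<close> only; it is propagated to all times by
  \<open>flow_parameter_derivative\<close>, after which uniqueness identifies \<open>Z\<close> with
  \<open>W\<close>.\<close>

theorem commuting_flows:
  fixes f g :: "'a::euclidean_space \<Rightarrow> 'a" and Z W :: "real \<Rightarrow> real \<Rightarrow> 'a"
  assumes f: "polynomial_function f" and g: "polynomial_function g"
    and bracket: "\<And>z. \<exists>w. ((\<lambda>s. f (z + s *\<^sub>R g z)) has_vector_derivative w) (at 0) \<and>
                       ((\<lambda>s. g (z + s *\<^sub>R f z)) has_vector_derivative w) (at 0)"
    and X: "open X" "connected X" "0 \<in> X" and T: "connected T" "0 \<in> T"
    and Zt: "\<And>t. t \<in> T \<Longrightarrow> (Z 0 has_vector_derivative g (Z 0 t)) (at t)"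
    and Zx: "\<And>x t. x \<in> X \<Longrightarrow> t \<in> T \<Longrightarrow> ((\<lambda>x. Z x t) has_vector_derivative f (Z x t)) (at x)"
    and Wx: "\<And>x. x \<in> X \<Longrightarrow> ((\<lambda>x. W x 0) has_vector_derivative f (W x 0)) (at x)"
    and Wt: "\<And>x t. x \<in> X \<Longrightarrow> t \<in> T \<Longrightarrow> (W x has_vector_derivative g (W x t)) (at t)"
    and init: "Z 0 0 = W 0 0"
    and x: "x \<in> X" and t: "t \<in> T"
  shows "Z x t = W x t"
proof -
  obtain f' where f': "\<And>z. (f has_derivative blinfun_apply (f' z)) (at z)" "continuous_on UNIV f'"
    using polynomial_function_C1 f by blast
  obtain g' where g': "\<And>z. (g has_derivative blinfun_apply (g' z)) (at z)" "continuous_on UNIV g'"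
    using polynomial_function_C1 g by blast
  have chain: "((\<lambda>s. h (c s)) has_vector_derivative h' v) (at s)"
    if "(h has_derivative h') (at (c s))" "(c has_vector_derivative v) (at s)"
    for h :: "'a \<Rightarrow> 'a" and h' c v s
    using vector_derivative_diff_chain_within[of c v s UNIV h h'] that
    by (auto simp: o_def intro: has_derivative_at_withinI)
  have line: "((\<lambda>s. z + s *\<^sub>R v) has_vector_derivative v) (at 0)" for z v :: 'a
    by (auto intro!: derivative_eq_intros)
  have comm: "f' z (g z) = g' z (f z)" for z
  proof -
    obtain w where w: "((\<lambda>s. f (z + s *\<^sub>R g z)) has_vector_derivative w) (at 0)"
        "((\<lambda>s. g (z + s *\<^sub>R f z)) has_vector_derivative w) (at 0)"
      using bracket by blast
    have "((\<lambda>s. f (z + s *\<^sub>R g z)) has_vector_derivative f' z (g z)) (at 0)"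
         "((\<lambda>s. g (z + s *\<^sub>R f z)) has_vector_derivative g' z (f z)) (at 0)"
      by (rule chain[OF _ line], simp add: f' g')+
    with w show ?thesis by (metis vector_derivative_unique_at)
  qed
  have Wxt: "((\<lambda>x. W x t) has_vector_derivative f (W x t)) (at x)" if x: "x \<in> X" for x
  proof (cases "0 \<le> t")
    case True
    note sub = subsetD[OF connected_contains_Icc_0[OF T t]]
    \<comment> \<open>The chain rule gives the derivative of \<open>f\<close> in direction
      \<open>g\<close>; \<open>comm\<close> exchanges the roles and produces the variational
      equation.\<close>
    have var: "((\<lambda>s. f (W x s)) has_vector_derivative g' (W x s) (f (W x s))) (at s)"
      if "s \<in> {0..t}" for s
      using chain[OF f'(1) Wt[OF x sub[OF that]]] by (simp add: comm)
    show ?thesis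
      by (rule flow_parameter_derivative[where f=f, OF g' X(1) x True Wt[OF _ sub] Wx[OF x] var])
  next
    \<comment> \<open>Negative times are reached by reversing \<open>t\<close>, which replaces
      \<open>g\<close> by its negative and preserves commutation.\<close>
    case False
    have "{0..-t} \<subseteq> uminus ` T"
      by (intro connected_contains_Icc_0 connected_reflect) (use T t in auto)
    then have sub: "- s \<in> T" if "s \<in> {0..-t}" for s
      using that by force
    have "((\<lambda>x. W x (- (- t))) has_vector_derivative f (W x (- (- t)))) (at x)"
    proof (rule flow_parameter_derivative[where W="\<lambda>x s. W x (- s)" and \<tau>="- t" and f=f and g="\<lambda>z. - g z" and g'="\<lambda>z. - g' z" and X=X])
      show "((\<lambda>s. f (W x (- s))) has_vector_derivative
          blinfun_apply (- g' (W x (- s))) (f (W x (- s)))) (at s)" if "s \<in> {0..- t}" for s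
      proof -
        have "((\<lambda>s. f (W x (- s))) has_vector_derivative f' (W x (- s)) (- g (W x (- s)))) (at s)"
          by (rule chain[OF f'(1) has_vector_derivative_reflect[OF Wt[OF x sub[OF that]]]])
        then show ?thesis by (simp add: comm blinfun.minus_left blinfun.minus_right)
      qed
    qed (use False X x in \<open>auto intro!: has_vector_derivative_reflect Wt Wx sub
          derivative_eq_intros g' continuous_intros simp: blinfun.minus_left\<close>)
    then show ?thesis by simp
  qed
  \<comment> \<open>Uniqueness is used twice: for the \<open>t\<close>-flow on the axis
    \<open>x = 0\<close>, then for the \<open>x\<close>-flow at fixed \<open>t\<close>.\<close>
  have "Z 0 t = W 0 t"
    by (rule flow_unique[OF g T t]) (use Zt Wt X init in auto)
  then show ?thesis
    using flow_unique[OF f X(2,3) x, of "\<lambda>x. Z x t" "\<lambda>x. W x t"] Zx[OF _ t] Wxt by blast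
qed

section \<open>Lie derivatives of polynomials along a polynomial flow\<close>

lemma real_polynomial_function_flow_derivative:
  fixes f :: "'a::euclidean_space \<Rightarrow> 'a"
  assumes "real_polynomial_function p" and f: "polynomial_function f"
  shows "\<exists>p'. real_polynomial_function p' \<and>
    (\<forall>y s. (y has_vector_derivative f (y s)) (at s) \<longrightarrow>
        ((\<lambda>s. p (y s)) has_real_derivative p' (y s)) (at s))"
  using assms(1)
proof (induction p rule: real_polynomial_function.induct)
  case (linear h)
  then show ?case
    using f unfolding polynomial_function_def has_real_derivative_iff_has_vector_derivative
    by (intro exI[of _ "h \<circ> f"] conjI) (blast, simp add: bounded_linear.has_vector_derivative)
next
  case (const c)
  then show ?case by (intro exI[of _ "\<lambda>_. 0"]) auto
next
  case (add p q)
  then obtain p' q' where "real_polynomial_function p'" "real_polynomial_function q'"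
    "\<And>y s. (y has_vector_derivative f (y s)) (at s) \<Longrightarrow> ((\<lambda>s. p (y s)) has_real_derivative p' (y s)) (at s)"
    "\<And>y s. (y has_vector_derivative f (y s)) (at s) \<Longrightarrow> ((\<lambda>s. q (y s)) has_real_derivative q' (y s)) (at s)"
    by blast
  then show ?case by (intro exI[of _ "\<lambda>z. p' z + q' z"]) (auto intro!: derivative_eq_intros)
next
  case (mult p q)
  then obtain p' q' where "real_polynomial_function p'" "real_polynomial_function q'"
    "\<And>y s. (y has_vector_derivative f (y s)) (at s) \<Longrightarrow> ((\<lambda>s. p (y s)) has_real_derivative p' (y s)) (at s)"
    "\<And>y s. (y has_vector_derivative f (y s)) (at s) \<Longrightarrow> ((\<lambda>s. q (y s)) has_real_derivative q' (y s)) (at s)"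
    by blast
  with mult show ?case
    by (intro exI[of _ "\<lambda>z. p' z * q z + q' z * p z"]) (auto intro!: derivative_eq_intros)
qed

text \<open>On the open set \<open>X\<close> every iterated derivative is again a polynomial in the
  state, hence differentiable. This gives the values of \<open>deriv\<close> in a jet their intended
  meaning.\<close>

lemma iterated_deriv_along_flow:
  fixes f :: "'a::euclidean_space \<Rightarrow> 'a" and y :: "real \<Rightarrow> 'a"
  assumes p: "real_polynomial_function p" and f: "polynomial_function f" and X: "open X"
    and y: "\<And>x. x \<in> X \<Longrightarrow> (y has_vector_derivative f (y x)) (at x)"
    and x: "x \<in> X"
  shows "((\<lambda>x. (deriv ^^ k) (\<lambda>x. p (y x)) x) has_real_derivative
           (deriv ^^ Suc k) (\<lambda>x. p (y x)) x) (at x)"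
proof -
  have "\<exists>p'. real_polynomial_function p' \<and> (\<forall>x\<in>X. (deriv ^^ k) (\<lambda>x. p (y x)) x = p' (y x))" for k
  proof (induction k)
    case 0
    then show ?case using p by auto
  next
    case (Suc k)
    then obtain p1 where p1: "real_polynomial_function p1"
        "\<And>x. x \<in> X \<Longrightarrow> (deriv ^^ k) (\<lambda>x. p (y x)) x = p1 (y x)" by blast
    obtain p2 where p2: "real_polynomial_function p2"
        "\<And>x. x \<in> X \<Longrightarrow> ((\<lambda>x. p1 (y x)) has_real_derivative p2 (y x)) (at x)"
      using real_polynomial_function_flow_derivative[OF p1(1) f] y by blast
    have "(deriv ^^ Suc k) (\<lambda>x. p (y x)) x = p2 (y x)" if "x \<in> X" for x
    proof -
      have "((deriv ^^ k) (\<lambda>x. p (y x)) has_real_derivative p2 (y x)) (at x)"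
        using p1(2) by (intro has_field_derivative_transform_within_open[OF p2(2) X]) (auto simp: that)
      then show ?thesis by (simp add: DERIV_imp_deriv)
    qed
    with p2 show ?case by blast
  qed
  from this[of k] obtain p1 where p1: "real_polynomial_function p1"
        "\<And>x. x \<in> X \<Longrightarrow> (deriv ^^ k) (\<lambda>x. p (y x)) x = p1 (y x)" by blast
  obtain p2 where p2: "\<And>x. x \<in> X \<Longrightarrow> ((\<lambda>x. p1 (y x)) has_real_derivative p2 (y x)) (at x)"
    using real_polynomial_function_flow_derivative[OF p1(1) f] y by metis
  have "((deriv ^^ k) (\<lambda>x. p (y x)) has_real_derivative p2 (y x)) (at x)"
    using p1(2) by (intro has_field_derivative_transform_within_open[OF p2 X]) (auto simp: x)
  then show ?thesis by (simp add: DERIV_imp_deriv)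
qed

section \<open>Differential polynomials\<close>

text \<open>\<open>L\<close> is the directional derivative of \<open>f\<close> on jet space,
  characterised by the chain rule along arbitrary curves of jets and by additivity in the direction.
  No topology on the infinite jet space is involved.\<close>

definition jet_derivative :: "dpol \<Rightarrow> ((nat \<Rightarrow> real) \<Rightarrow> (nat \<Rightarrow> real) \<Rightarrow> dpol) \<Rightarrow> bool" where
  "jet_derivative f L \<longleftrightarrow>
     (\<forall>Q R V W s. (\<forall>k. ((\<lambda>s. Q s k) has_real_derivative V k) (at s)) \<longrightarrow>
       (\<forall>k. ((\<lambda>s. R s k) has_real_derivative W k) (at s)) \<longrightarrow>
       ((\<lambda>s. f (Q s) (R s)) has_real_derivative L (Q s) (R s) V W) (at s)) \<and>
     (\<forall>Q R V W V' W'. L Q R (\<lambda>k. V k + V' k) (\<lambda>k. W k + W' k) = L Q R V W + L Q R V' W')"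

lemma jet_derivativeD:
  assumes "jet_derivative f L"
  shows "(\<And>k. ((\<lambda>s. Q s k) has_real_derivative V k) (at s)) \<Longrightarrow>
       (\<And>k. ((\<lambda>s. R s k) has_real_derivative W k) (at s)) \<Longrightarrow>
       ((\<lambda>s. f (Q s) (R s)) has_real_derivative L (Q s) (R s) V W) (at s)"
    and "L Q' R' (\<lambda>k. V k + V' k) (\<lambda>k. W k + W' k) = L Q' R' V W + L Q' R' V' W'"
  using assms unfolding jet_derivative_def by auto

lemma dpoly_jet_derivative:
  assumes "dpoly f"
  shows "\<exists>L. jet_derivative f L"
  using assms
proof (induction rule: dpoly.induct)
  case (dconst c)
  show ?case by (intro exI[of _ "\<lambda>_ _ _ _. 0"]) (auto simp: jet_derivative_def)
next
  case (dqvar k)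
  show ?case by (intro exI[of _ "\<lambda>_ _ V _. V k"]) (auto simp: jet_derivative_def)
next
  case (drvar k)
  show ?case by (intro exI[of _ "\<lambda>_ _ _ W. W k"]) (auto simp: jet_derivative_def)
next
  case (dadd f g)
  then obtain L M where "jet_derivative f L" "jet_derivative g M" by blast
  then have "jet_derivative (\<lambda>Q R. f Q R + g Q R) (\<lambda>Q R V W. L Q R V W + M Q R V W)"
    unfolding jet_derivative_def by (simp add: DERIV_add)
  then show ?case by blast
next
  case (dmult f g)
  then obtain L M where "jet_derivative f L" "jet_derivative g M" by blast
  note LM = jet_derivativeD[OF this(1)] jet_derivativeD[OF this(2)]
  have "jet_derivative (\<lambda>Q R. f Q R * g Q R)
      (\<lambda>Q R V W. L Q R V W * g Q R + M Q R V W * f Q R)"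
    unfolding jet_derivative_def
    by (intro conjI allI impI DERIV_mult LM(1,3)) (auto simp: LM(2,4) distrib_right)
  then show ?case by blast
qed

lemma has_real_derivative_line:
  "((\<lambda>s. a + s * b) has_real_derivative b) (at (0::real))"
  by (auto intro!: derivative_eq_intros)

lemma jet_derivative_line:
  assumes "jet_derivative f L"
  shows "((\<lambda>s. f (\<lambda>k. Q k + s * V k) (\<lambda>k. R k + s * W k)) has_real_derivative L Q R V W) (at 0)"
  using jet_derivativeD(1)[OF assms, of "\<lambda>h k. Q k + h * V k" V 0 "\<lambda>h k. R k + h * W k" W]
  by (simp add: has_real_derivative_line)

lemma Dx_eq_jet_derivative:
  assumes "jet_derivative f L"
  shows "Dx f Q R = L Q R (\<lambda>k. Q (Suc k)) (\<lambda>k. R (Suc k))"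
  unfolding Dx_def by (intro DERIV_imp_deriv jet_derivative_line assms)

lemma Dx_chain:
  assumes "dpoly f"
    and "\<And>k. ((\<lambda>s. Q s k) has_real_derivative Q s (Suc k)) (at s)"
    and "\<And>k. ((\<lambda>s. R s k) has_real_derivative R s (Suc k)) (at s)"
  shows "((\<lambda>s. f (Q s) (R s)) has_real_derivative Dx f (Q s) (R s)) (at s)"
proof -
  obtain L where L: "jet_derivative f L" using dpoly_jet_derivative[OF assms(1)] by blast
  show ?thesis
    unfolding Dx_eq_jet_derivative[OF L] by (rule jet_derivativeD(1)[OF L assms(2,3)])
qed

lemma has_real_derivative_Dx:
  assumes "dpoly f"
  shows "((\<lambda>s. f (\<lambda>k. Q k + s * Q (Suc k)) (\<lambda>k. R k + s * R (Suc k))) has_real_derivative Dx f Q R) (at 0)"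
proof -
  obtain L where L: "jet_derivative f L" using dpoly_jet_derivative[OF assms(1)] by blast
  show ?thesis
    unfolding Dx_eq_jet_derivative[OF L] by (rule jet_derivative_line[OF L])
qed

text \<open>Supplies the starting order for the descent in
  \<open>dpoly_constant_if_Dx_zero\<close>.\<close>

lemma dpoly_finite_order:
  assumes "dpoly f"
  shows "\<exists>m. \<forall>Q R Q' R'. (\<forall>k<m. Q k = Q' k \<and> R k = R' k) \<longrightarrow> f Q R = f Q' R'"
  using assms
proof (induction rule: dpoly.induct)
  case (dadd f g)
  then obtain m n where "\<forall>Q R Q' R'. (\<forall>k<m. Q k = Q' k \<and> R k = R' k) \<longrightarrow> f Q R = f Q' R'"
    "\<forall>Q R Q' R'. (\<forall>k<n. Q k = Q' k \<and> R k = R' k) \<longrightarrow> g Q R = g Q' R'" by blast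
  then show ?case by (intro exI[of _ "max m n"]) (metis less_max_iff_disj)
next
  case (dmult f g)
  then obtain m n where "\<forall>Q R Q' R'. (\<forall>k<m. Q k = Q' k \<and> R k = R' k) \<longrightarrow> f Q R = f Q' R'"
    "\<forall>Q R Q' R'. (\<forall>k<n. Q k = Q' k \<and> R k = R' k) \<longrightarrow> g Q R = g Q' R'" by blast
  then show ?case by (intro exI[of _ "max m n"]) (metis less_max_iff_disj)
qed blast+

lemma constant_if_derivative_zero:
  fixes u :: "real \<Rightarrow> real"
  assumes "\<And>s. (u has_real_derivative 0) (at s)"
  shows "u s = u t"
  using DERIV_isconst_all[of u s t] assms by blast

text \<open>If \<open>f\<close> involves jet variables of order at most \<open>m\<close>, then \<open>Dx f\<close> is affine in the
  variables of order \<open>Suc m\<close>, with the partial derivatives of \<open>f\<close> with respect to the variables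
  of order \<open>m\<close> as coefficients.  If \<open>Dx f\<close> vanishes, these variables do not occur in \<open>f\<close>.\<close>

lemma dpoly_constant_if_Dx_zero:
  assumes f: "dpoly f" and D: "\<And>Q R. Dx f Q R = 0"
  shows "f Q R = f (\<lambda>_. 0) (\<lambda>_. 0)"
proof -
  obtain L where jd: "jet_derivative f L" using dpoly_jet_derivative[OF f] by blast
  note L = jet_derivativeD(1)[OF jd] and add = jet_derivativeD(2)[OF jd]
    and line = jet_derivative_line[OF jd]
  have DL: "L Q R (\<lambda>k. Q (Suc k)) (\<lambda>k. R (Suc k)) = 0" for Q R
    using D by (simp add: Dx_eq_jet_derivative[OF jd])
  have "\<forall>Q R. f Q R = f (\<lambda>_. 0) (\<lambda>_. 0)"
    if "\<forall>Q R Q' R'. (\<forall>k<m. Q k = Q' k \<and> R k = R' k) \<longrightarrow> f Q R = f Q' R'" for m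
    using that
  proof (induction m)
    case (Suc m)
    define e where "e = (\<lambda>k. if k = m then 1 else 0 :: real)"
    have LL: "L Q R V W = L Q' R' V W"
      if "\<forall>k<Suc m. Q k = Q' k \<and> R k = R' k" for Q R Q' R' V W
    proof -
      have "f (\<lambda>k. Q k + s * V k) (\<lambda>k. R k + s * W k) = f (\<lambda>k. Q' k + s * V k) (\<lambda>k. R' k + s * W k)" for s
        by (rule Suc.prems[rule_format]) (use that in auto)
      then show ?thesis using DERIV_unique[OF line[of Q V R W]] line[of Q' V R' W] by simp
    qed
    have LQ: "L Q R e (\<lambda>_. 0) = 0" for Q R
    proof -
      \<comment> \<open>Raising the variable of order \<open>Suc m\<close> by 1 leaves the base
        point seen by \<open>L\<close> unchanged and adds \<open>e\<close> to the direction. Both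
        total derivatives vanish, so their difference, the partial derivative of order
        \<open>m\<close>, vanishes too.\<close>
      define Q' where "Q' = (\<lambda>k. if k = Suc m then Q k + 1 else Q k)"
      have "0 = L Q' R (\<lambda>k. Q' (Suc k)) (\<lambda>k. R (Suc k))" using DL by simp
      also have "\<dots> = L Q R (\<lambda>k. Q' (Suc k)) (\<lambda>k. R (Suc k))"
        by (rule LL) (auto simp: Q'_def)
      also have "(\<lambda>k. Q' (Suc k)) = (\<lambda>k. Q (Suc k) + e k)" by (auto simp: Q'_def e_def)
      also have "L Q R (\<lambda>k. Q (Suc k) + e k) (\<lambda>k. R (Suc k)) = L Q R e (\<lambda>_. 0)"
        using add[of Q R "\<lambda>k. Q (Suc k)" e "\<lambda>k. R (Suc k)" "\<lambda>_. 0"] DL by simp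
      finally show ?thesis by simp
    qed
    have LR: "L Q R (\<lambda>_. 0) e = 0" for Q R
    proof -
      define R' where "R' = (\<lambda>k. if k = Suc m then R k + 1 else R k)"
      have "0 = L Q R' (\<lambda>k. Q (Suc k)) (\<lambda>k. R' (Suc k))" using DL by simp
      also have "\<dots> = L Q R (\<lambda>k. Q (Suc k)) (\<lambda>k. R' (Suc k))"
        by (rule LL) (auto simp: R'_def)
      also have "(\<lambda>k. R' (Suc k)) = (\<lambda>k. R (Suc k) + e k)" by (auto simp: R'_def e_def)
      also have "L Q R (\<lambda>k. Q (Suc k)) (\<lambda>k. R (Suc k) + e k) = L Q R (\<lambda>_. 0) e"
        using add[of Q R "\<lambda>k. Q (Suc k)" "\<lambda>_. 0" "\<lambda>k. R (Suc k)" e] DL by simp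
      finally show ?thesis by simp
    qed
    have upd: "((\<lambda>s. if k = m then s else y k) has_real_derivative e k) (at s)" for k s and y :: "nat \<Rightarrow> real"
      by (cases "k = m") (auto simp: e_def)
    have self: "(\<lambda>k. if k = m then y m else y k) = y" for y :: "nat \<Rightarrow> real" by auto
    \<comment> \<open>With zero partial derivative, the variable of order \<open>m\<close> may be
      overwritten freely, so \<open>f\<close> depends on orders below \<open>m\<close> only.\<close>
    have updQ: "f (\<lambda>k. if k = m then c else Q k) R = f Q R" for c Q R
    proof -
      have "((\<lambda>s. f (\<lambda>k. if k = m then s else Q k) R) has_real_derivative 0) (at s)" for s
        using L[of "\<lambda>s k. if k = m then s else Q k" e s "\<lambda>_. R" "\<lambda>_. 0"]
        by (simp add: LQ upd)
      from constant_if_derivative_zero[of "\<lambda>s. f (\<lambda>k. if k = m then s else Q k) R", OF this, of c "Q m"]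
      show ?thesis by (simp add: self)
    qed
    have updR: "f Q (\<lambda>k. if k = m then c else R k) = f Q R" for c Q R
    proof -
      have "((\<lambda>s. f Q (\<lambda>k. if k = m then s else R k)) has_real_derivative 0) (at s)" for s
        using L[of "\<lambda>_. Q" "\<lambda>_. 0" s "\<lambda>s k. if k = m then s else R k" e]
        by (simp add: LR upd)
      from constant_if_derivative_zero[of "\<lambda>s. f Q (\<lambda>k. if k = m then s else R k)", OF this, of c "R m"]
      show ?thesis by (simp add: self)
    qed
    have "f Q R = f Q' R'" if "\<forall>k<m. Q k = Q' k \<and> R k = R' k" for Q R Q' R'
    proof -
      have "f Q R = f (\<lambda>k. if k = m then Q' m else Q k) (\<lambda>k. if k = m then R' m else R k)"
        by (simp only: updQ updR)
      also have "\<dots> = f Q' R'" by (rule Suc.prems[rule_format]) (use that in \<open>auto simp: less_Suc_eq\<close>)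
      finally show ?thesis .
    qed
    then show ?case by (intro Suc.IH) blast
  qed blast
  then show ?thesis using dpoly_finite_order[OF f] by blast
qed

lemma dpoly_sum:
  assumes "finite I" "\<And>i. i \<in> I \<Longrightarrow> dpoly (f i)"
  shows "dpoly (\<lambda>Q R. \<Sum>i\<in>I. f i Q R)"
  using assms by (induction I rule: finite_induct) (auto intro: dpoly.intros)

text \<open>The quantity \<open>a\<^sup>2 + b c\<close> (up to sign the determinant of the Lax matrix, as a formal power
  series in the inverse spectral parameter) has zero total derivative, hence it equals its value
  at \<open>u = 0\<close>.  This is what fixes the integration constants.\<close>

lemma akns_determinant:
  assumes "akns_seq a b c" and "0 < k"
  shows "(\<Sum>i=0..k. a i Q R * a (k - i) Q R + b i Q R * c (k - i) Q R) = 0"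
proof -
  note akns = assms(1)[unfolded akns_seq_def]
  have p: "dpoly (a i)" "dpoly (b i)" "dpoly (c i)" for i using akns by auto
  define S where "S = (\<lambda>Q R. \<Sum>i=0..k. a i Q R * a (k - i) Q R + b i Q R * c (k - i) Q R)"
  have "dpoly S" unfolding S_def by (intro dpoly_sum dpoly.intros p) auto
  have "Dx S Q R = 0" for Q R
  proof -
    define fa fb fc where "fa = Abs_fps (\<lambda>i. a i Q R)" "fb = Abs_fps (\<lambda>i. b i Q R)" "fc = Abs_fps (\<lambda>i. c i Q R)"
    define da db dc where "da = Abs_fps (\<lambda>i. Dx (a i) Q R)" "db = Abs_fps (\<lambda>i. Dx (b i) Q R)"
      "dc = Abs_fps (\<lambda>i. Dx (c i) Q R)"
    note defs = fa_fb_fc_def da_db_dc_def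
    have "Dx S Q R = (\<Sum>i=0..k. Dx (a i) Q R * a (k - i) Q R + Dx (a (k - i)) Q R * a i Q R
         + (Dx (b i) Q R * c (k - i) Q R + Dx (c (k - i)) Q R * b i Q R))"
    proof (rule DERIV_unique[OF has_real_derivative_Dx[OF \<open>dpoly S\<close>]])
      show "((\<lambda>s. S (\<lambda>k. Q k + s * Q (Suc k)) (\<lambda>k. R k + s * R (Suc k))) has_real_derivative
        (\<Sum>i=0..k. Dx (a i) Q R * a (k - i) Q R + Dx (a (k - i)) Q R * a i Q R
         + (Dx (b i) Q R * c (k - i) Q R + Dx (c (k - i)) Q R * b i Q R))) (at 0)"
      proof -
        have m: "((\<lambda>s. f (\<lambda>k. Q k + s * Q (Suc k)) (\<lambda>k. R k + s * R (Suc k)) *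
            g (\<lambda>k. Q k + s * Q (Suc k)) (\<lambda>k. R k + s * R (Suc k)))
            has_real_derivative (Dx f Q R * g Q R + Dx g Q R * f Q R)) (at 0)"
          if "dpoly f" "dpoly g" for f g
          using DERIV_mult[OF has_real_derivative_Dx[OF that(1), of Q R] has_real_derivative_Dx[OF that(2), of Q R]]
          by simp
        show ?thesis unfolding S_def by (intro DERIV_sum DERIV_add m p)
      qed
    qed
    also have "\<dots> = fps_nth (da * fa + fa * da + (db * fc + fb * dc)) k"
      unfolding fps_add_nth fps_mult_nth defs fps_nth_Abs_fps
      by (simp add: sum.distrib mult.commute)
    also have "da * fa + fa * da + (db * fc + fb * dc) = 0"
    proof -
      define q r where "q = fps_const (Q 0)" "r = fps_const (R 0)"
      have bc: "b (Suc i) Q R = - 1/2 * Dx (b i) Q R - Q 0 * a i Q R"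
               "c (Suc i) Q R = 1/2 * Dx (c i) Q R - R 0 * a i Q R"
               "Dx (a (Suc i)) Q R = 1/2 * (Q 0 * Dx (c i) Q R + R 0 * Dx (b i) Q R)" for i
        using akns by metis+
      have z: "b 0 Q R = 0" "c 0 Q R = 0" using akns by auto
      have "Dx (a 0) Q R = 0" using akns by (simp add: Dx_def)
      \<comment> \<open>The recursion in generating series. Inserting the formulas for
        \<open>b (Suc i)\<close> and \<open>c (Suc i)\<close> shows that
        \<open>Dx (a (Suc i))\<close> is \<open>Q 0 * c (Suc i) - R 0 * b (Suc i)\<close>; in 2 and
        3 the factor \<open>fps_X\<close> absorbs the index shift and is cancelled at the
        end.\<close>
      then have 1: "da = q * fc - r * fb"
        by (auto simp: fps_eq_iff defs q_r_def z bc algebra_simps)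
          (case_tac n; simp add: z bc algebra_simps)
      have 2: "fps_X * db = - 2 * fb - 2 * fps_X * q * fa"
        by (auto simp: fps_eq_iff defs q_r_def z fps_numeral_fps_const mult.assoc)
          (case_tac n; simp add: z bc algebra_simps)
      have 3: "fps_X * dc = 2 * fc + 2 * fps_X * r * fa"
        by (auto simp: fps_eq_iff defs q_r_def z fps_numeral_fps_const mult.assoc)
          (case_tac n; simp add: z bc algebra_simps)
      have "fps_X * (da * fa + fa * da + (db * fc + fb * dc))
          = 2 * fps_X * da * fa + (fps_X * db) * fc + fb * (fps_X * dc)" by (simp add: algebra_simps)
      also have "\<dots> = 0" unfolding 1 2 3 by (simp add: algebra_simps)
      finally show ?thesis by simp
    qed
    finally show ?thesis by simp
  qed
  then have "S Q R = S (\<lambda>_. 0) (\<lambda>_. 0)" by (rule dpoly_constant_if_Dx_zero[OF \<open>dpoly S\<close>])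
  also have "\<dots> = 0"
  proof -
    \<comment> \<open>At \<open>u = 0\<close> only \<open>a 0\<close> survives among the
      \<open>a i\<close>, and a product whose indices add up to \<open>k > 0\<close> has a factor of
      positive index.\<close>
    have z: "a i (\<lambda>_. 0) (\<lambda>_. 0) = 0" if "0 < i" for i
      using that akns by (metis Suc_pred)
    have z': "b i (\<lambda>_. 0) (\<lambda>_. 0) = 0" for i using akns by (metis not0_implies_Suc)
    show ?thesis unfolding S_def z'
    proof (intro sum.neutral ballI)
      fix i assume "i \<in> {0..k}"
      then consider "0 < i" | "0 < k - i" using \<open>0 < k\<close> by force
      then show "a i (\<lambda>_. 0) (\<lambda>_. 0) * a (k - i) (\<lambda>_. 0) (\<lambda>_. 0) + 0 * c (k - i) (\<lambda>_. 0) (\<lambda>_. 0) = 0"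
        by cases (auto simp: z)
    qed
  qed
  finally show ?thesis by (simp add: S_def)
qed

section \<open>The Hamiltonians as coefficients of a formal square root\<close>

lemma numeral_mult_fps_nth: "fps_nth (numeral k * f) n = numeral k * fps_nth (f :: real fps) n"
  by (simp add: fps_numeral_fps_const)

lemma length_dl: "length (dl n) = Suc n"
  by (induction n) (simp_all add: Let_def)

text \<open>Later lists extend earlier ones, so every sufficiently long list shows the same
  coefficients.\<close>

lemma dl_nth: "i \<le> n \<Longrightarrow> dl n ! i = dd i"
proof (induction n)
  case (Suc n)
  show ?case
  proof (cases "i = Suc n")
    case False
    then have "i \<le> n" using Suc.prems by simp
    then show ?thesis using Suc.IH by (simp add: Let_def nth_append length_dl)
  qed (simp add: dd_def)
qed (simp add: dd_def)

lemma dd_small: "dd 0 = 1" "dd (Suc 0) = - 1/8" "dd 2 = 3/128"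
  by (simp_all add: dd_def Let_def numeral_2_eq_2 nth_append)

lemma dd_rec:
  assumes "3 \<le> n"
  shows "dd n = - 1/2 * (\<Sum>i=1..n-1. dd i * dd (n - i)) - 1/4 * dd (n - 1)
    - 1/8 * (\<Sum>i=1..n-2. dd i * dd (n - i - 1))"
proof -
  obtain m where n: "n = Suc m" using assms by (cases n) auto
  have "dd n = - 1/2 * (\<Sum>i=1..n-1. dl m ! i * dl m ! (n - i)) - 1/4 * dl m ! (n - 1)
    - 1/8 * (\<Sum>i=1..n-2. dl m ! i * dl m ! (n - i - 1))"
    using assms nth_append_length[of "dl m"] by (simp add: dd_def n Let_def length_dl)
  also have "(\<Sum>i=1..n-1. dl m ! i * dl m ! (n - i)) = (\<Sum>i=1..n-1. dd i * dd (n - i))"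
    by (intro sum.cong) (auto simp: n dl_nth)
  also have "(\<Sum>i=1..n-2. dl m ! i * dl m ! (n - i - 1)) = (\<Sum>i=1..n-2. dd i * dd (n - i - 1))"
    by (intro sum.cong) (auto simp: n dl_nth)
  finally show ?thesis by (simp add: n dl_nth)
qed

text \<open>The sums in the recursion for \<open>dd\<close> omit both end terms of the convolution;
  as \<open>dd 0 = 1\<close>, restoring them costs \<open>2 * dd n\<close>.\<close>

lemma sum_dd_dd:
  assumes "1 \<le> n"
  shows "(\<Sum>i=0..n. dd i * dd (n - i)) = 2 * dd n + (\<Sum>i=1..n-1. dd i * dd (n - i))"
proof -
  have "{0..n} = insert 0 (insert n {1..n-1})" using assms by auto
  then show ?thesis using assms by (simp add: dd_small)
qed

definition dser :: "real fps" where "dser = Abs_fps dd"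

text \<open>The series \<open>dser\<close> is the expansion of \<open>(1 + X/4)\<^bsup>-1/2\<^esup>\<close>.\<close>

lemma dser_square: "dser\<^sup>2 * (1 + fps_const (1/4) * fps_X) = 1"
proof (rule fps_ext)
  fix n
  have sq: "fps_nth (dser\<^sup>2) n = (\<Sum>i=0..n. dd i * dd (n - i))" for n
    by (simp add: power2_eq_square fps_mult_nth dser_def)
  have "fps_nth (dser\<^sup>2 * (1 + fps_const (1/4) * fps_X)) n
      = fps_nth (dser\<^sup>2) n + 1/4 * (if n = 0 then 0 else fps_nth (dser\<^sup>2) (n - 1))"
    by (simp add: distrib_left mult.left_commute[of "dser\<^sup>2"])
  also have "\<dots> = fps_nth 1 n"
  proof -
    \<comment> \<open>The explicit initial values settle the degrees below 3; from there on the
      recursion is exactly the vanishing of this coefficient.\<close>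
    consider "n = 0" | "n = 1" | "n = 2" | "3 \<le> n" by linarith
    then show ?thesis
    proof cases
      case 3
      then show ?thesis
        using sum_dd_dd[of 2] sum_dd_dd[of 1] by (simp add: sq dd_small)
    next
      case 4
      then show ?thesis
        using dd_rec[OF 4] sum_dd_dd[of n] sum_dd_dd[of "n - 1"] by (simp add: sq field_simps flip: numeral_2_eq_2)
    qed (simp_all add: sq dd_small numeral_2_eq_2 flip: numeral_2_eq_2)
  qed
  finally show "fps_nth (dser\<^sup>2 * (1 + fps_const (1/4) * fps_X)) n = fps_nth 1 n" .
qed

lemma finite_comps: "finite (comps k s)"
proof (rule finite_subset)
  show "comps k s \<subseteq> {xs. set xs \<subseteq> {..s} \<and> length xs = k}"
    by (auto simp: comps_def member_le_sum_list)
  show "finite {xs. set xs \<subseteq> {..s} \<and> length xs = k}" by (rule finite_lists_length_eq) simp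
qed

text \<open>Splitting off the first part of a composition matches multiplication by one more factor
  \<open>P\<close>. The restriction to positive parts corresponds to the vanishing constant
  term.\<close>

lemma sum_comps:
  fixes P :: "real fps"
  assumes "fps_nth P 0 = 0"
  shows "(\<Sum>is\<in>comps k s. prod_list (map (fps_nth P) is)) = fps_nth (P ^ k) s"
proof (induction k arbitrary: s)
  case 0
  have "comps 0 s = (if s = 0 then {[]} else {})" by (auto simp: comps_def)
  then show ?case by simp
next
  case (Suc k)
  have "(\<Sum>is\<in>comps (Suc k) s. prod_list (map (fps_nth P) is))
      = (\<Sum>(i, is)\<in>(SIGMA i:{1..s}. comps k (s - i)). fps_nth P i * prod_list (map (fps_nth P) is))"
    by (rule sum.reindex_bij_witness[where i="\<lambda>(i, is). i # is" and j="\<lambda>is. (hd is, tl is)"])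
      (auto simp: comps_def length_Suc_conv)
  also have "\<dots> = (\<Sum>i\<in>{1..s}. fps_nth P i * fps_nth (P ^ k) (s - i))"
    by (subst sum.Sigma[symmetric]) (auto simp: finite_comps sum_distrib_left simp flip: Suc.IH)
  also have "\<dots> = (\<Sum>i\<in>{0..s}. fps_nth P i * fps_nth (P ^ k) (s - i))"
    by (rule sum.mono_neutral_left) (use assms in \<open>auto simp: not_le Suc_le_eq\<close>)
  finally show ?case by (simp add: fps_mult_nth)
qed

section \<open>Coefficientwise differentiation of power series in a real parameter\<close>

definition fps_has_deriv :: "(real \<Rightarrow> real fps) \<Rightarrow> real fps \<Rightarrow> real \<Rightarrow> bool" where
  "fps_has_deriv P P' s \<longleftrightarrow>
     (\<forall>k. ((\<lambda>s. fps_nth (P s) k) has_real_derivative fps_nth P' k) (at s))"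

lemma fps_has_deriv_const: "fps_has_deriv (\<lambda>_. P) 0 s"
  by (simp add: fps_has_deriv_def)

lemma fps_has_deriv_add:
  "fps_has_deriv P P' s \<Longrightarrow> fps_has_deriv Q Q' s \<Longrightarrow> fps_has_deriv (\<lambda>s. P s + Q s) (P' + Q') s"
  by (simp add: fps_has_deriv_def DERIV_add)

lemma fps_has_deriv_diff:
  "fps_has_deriv P P' s \<Longrightarrow> fps_has_deriv Q Q' s \<Longrightarrow> fps_has_deriv (\<lambda>s. P s - Q s) (P' - Q') s"
  by (simp add: fps_has_deriv_def DERIV_diff)

lemma fps_has_deriv_mult:
  assumes "fps_has_deriv P P' s" "fps_has_deriv Q Q' s"
  shows "fps_has_deriv (\<lambda>s. P s * Q s) (P' * Q s + P s * Q') s"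
  unfolding fps_has_deriv_def
proof
  fix k
  have "((\<lambda>s. \<Sum>i=0..k. fps_nth (P s) i * fps_nth (Q s) (k - i)) has_real_derivative
      (\<Sum>i=0..k. fps_nth (P s) i * fps_nth Q' (k - i) + fps_nth P' i * fps_nth (Q s) (k - i))) (at s)"
    using assms unfolding fps_has_deriv_def by (intro DERIV_sum DERIV_mult') auto
  then show "((\<lambda>s. fps_nth (P s * Q s) k) has_real_derivative fps_nth (P' * Q s + P s * Q') k) (at s)"
    by (simp add: fps_mult_nth sum.distrib add.commute)
qed

lemma fps_has_deriv_power:
  assumes "fps_has_deriv P P' s"
  shows "fps_has_deriv (\<lambda>s. P s ^ k) (of_nat k * P s ^ (k - 1) * P') s"
proof (induction k)
  case 0
  then show ?case by (simp add: fps_has_deriv_const)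
next
  case (Suc k)
  have "P' * P s ^ k + P s * (of_nat k * P s ^ (k - 1) * P') = of_nat (Suc k) * P s ^ (Suc k - 1) * P'"
    by (cases k) (simp_all add: algebra_simps)
  then show ?case
    using fps_has_deriv_mult[OF assms Suc] by simp
qed

text \<open>The formal variable stands for the inverse of the spectral parameter.  The coefficients of
  \<open>casimir\<close> are the \<open>F\<^sub>m\<close>, and \<open>invroot\<close> is the inverse square root of
  \<open>1 + casimir / 4 = (genE - 1)\<^sup>2 + 2 genF genG\<close>.\<close>

definition genE :: "('n::finite \<Rightarrow> real) \<Rightarrow> ('n \<Rightarrow> real) \<Rightarrow> 'n st \<Rightarrow> real fps" where
  "genE lam mu z = fps_X * Abs_fps (\<lambda>k. ee lam mu k z)"
definition genF :: "('n::finite \<Rightarrow> real) \<Rightarrow> ('n \<Rightarrow> real) \<Rightarrow> 'n st \<Rightarrow> real fps" where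
  "genF lam mu z = fps_X * Abs_fps (\<lambda>k. ff lam mu k z)"
definition genG :: "('n::finite \<Rightarrow> real) \<Rightarrow> ('n \<Rightarrow> real) \<Rightarrow> 'n st \<Rightarrow> real fps" where
  "genG lam mu z = fps_X * Abs_fps (\<lambda>k. gg lam mu k z)"

definition casimir :: "('n::finite \<Rightarrow> real) \<Rightarrow> ('n \<Rightarrow> real) \<Rightarrow> 'n st \<Rightarrow> real fps" where
  "casimir lam mu z = 4 * (genE lam mu z * genE lam mu z + 2 * (genF lam mu z * genG lam mu z))
     - 8 * genE lam mu z"

definition invroot :: "('n::finite \<Rightarrow> real) \<Rightarrow> ('n \<Rightarrow> real) \<Rightarrow> 'n st \<Rightarrow> real fps" where
  "invroot lam mu z = fps_compose dser (casimir lam mu z)"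

definition alpha :: "('n::finite \<Rightarrow> real) \<Rightarrow> ('n \<Rightarrow> real) \<Rightarrow> 'n st \<Rightarrow> real fps" where
  "alpha lam mu z = invroot lam mu z * (genE lam mu z - 1)"
definition beta :: "('n::finite \<Rightarrow> real) \<Rightarrow> ('n \<Rightarrow> real) \<Rightarrow> 'n st \<Rightarrow> real fps" where
  "beta lam mu z = invroot lam mu z * genF lam mu z"
definition gamma :: "('n::finite \<Rightarrow> real) \<Rightarrow> ('n \<Rightarrow> real) \<Rightarrow> 'n st \<Rightarrow> real fps" where
  "gamma lam mu z = invroot lam mu z * genG lam mu z"

lemma casimir_nth_0 [simp]: "fps_nth (casimir lam mu z) 0 = 0"
  by (simp add: casimir_def genE_def genF_def genG_def)

lemma fps_nth_shift_mult:
  assumes "2 \<le> m"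
  shows "fps_nth ((fps_X * Abs_fps u) * (fps_X * Abs_fps v)) m = (\<Sum>i=1..m-1. u (i-1) * v (m-i-1) :: real)"
proof -
  have "fps_nth ((fps_X * Abs_fps u) * (fps_X * Abs_fps v)) m
      = (\<Sum>i=0..m. fps_nth (fps_X * Abs_fps u) i * fps_nth (fps_X * Abs_fps v) (m - i))"
    by (simp only: fps_mult_nth)
  also have "\<dots> = (\<Sum>i=1..m-1. fps_nth (fps_X * Abs_fps u) i * fps_nth (fps_X * Abs_fps v) (m - i))"
    by (rule sum.mono_neutral_right) (auto simp: not_le Suc_le_eq)
  also have "\<dots> = (\<Sum>i=1..m-1. u (i-1) * v (m-i-1))"
    by (intro sum.cong) auto
  finally show ?thesis .
qed

text \<open>The factor \<open>fps_X\<close> in each generating series turns the indices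
  \<open>i - 1\<close> and \<open>m - i - 1\<close> into those of a Cauchy product.\<close>

lemma FF_eq_casimir:
  assumes "1 \<le> m"
  shows "FF lam mu m z = fps_nth (casimir lam mu z) m"
proof (cases "m = 1")
  case True
  then show ?thesis
    by (simp add: FF_def casimir_def genE_def genF_def genG_def)
next
  case False
  then have "2 \<le> m" using assms by simp
  have "fps_nth (genE lam mu z * genE lam mu z) m = (\<Sum>i=1..m-1. ee lam mu (i-1) z * ee lam mu (m-i-1) z)"
     "fps_nth (genF lam mu z * genG lam mu z) m = (\<Sum>i=1..m-1. ff lam mu (i-1) z * gg lam mu (m-i-1) z)"
    unfolding genE_def genF_def genG_def by (rule fps_nth_shift_mult[OF \<open>2 \<le> m\<close>])+
  moreover have "fps_nth (genE lam mu z) m = ee lam mu (m - 1) z"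
    using assms by (simp add: genE_def)
  ultimately show ?thesis
    using False
    by (simp add: FF_def casimir_def numeral_mult_fps_nth sum.distrib sum_distrib_left mult.assoc)
qed

text \<open>The weights \<open>dd m / (m + 1)\<close> belong to the antiderivative of
  \<open>dser\<close>, composed with \<open>casimir\<close>. Stopping at \<open>m = n\<close> loses
  nothing, since \<open>casimir ^ (m + 1)\<close> starts in degree \<open>m + 1\<close> or
  later.\<close>

lemma Hn_eq:
  "Hn lam mu n z = - 1/4 * (\<Sum>m=0..n. dd m / real (m+1) * fps_nth (casimir lam mu z ^ (m+1)) (n+1))"
proof -
  have "(\<Sum>is\<in>comps (m+1) (n+1). prod_list (map (\<lambda>i. FF lam mu i z) is))
      = fps_nth (casimir lam mu z ^ (m+1)) (n+1)" for m
  proof -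
    have "(\<Sum>is\<in>comps (m+1) (n+1). prod_list (map (\<lambda>i. FF lam mu i z) is))
      = (\<Sum>is\<in>comps (m+1) (n+1). prod_list (map (fps_nth (casimir lam mu z)) is))"
      by (intro sum.cong arg_cong[where f=prod_list] map_cong refl) (auto simp: comps_def FF_eq_casimir)
    then show ?thesis by (simp add: sum_comps)
  qed
  then show ?thesis by (simp add: Hn_def)
qed

lemma one_plus_casimir:
  "1 + fps_const (1/4) * casimir lam mu z = (genE lam mu z - 1)\<^sup>2 + 2 * genF lam mu z * genG lam mu z"
proof -
  have quarter: "fps_const (1/4) * (4 * f) = f" "fps_const (1/4) * (8 * f) = 2 * f" for f :: "real fps"
    by (simp_all add: fps_eq_iff numeral_mult_fps_nth)
  show ?thesis
    unfolding casimir_def right_diff_distrib quarter by (simp add: power2_eq_square algebra_simps)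
qed

lemma invroot_square:
  "(invroot lam mu z)\<^sup>2 * ((genE lam mu z - 1)\<^sup>2 + 2 * genF lam mu z * genG lam mu z) = 1"
proof -
  have "1 = fps_compose (dser\<^sup>2 * (1 + fps_const (1/4) * fps_X)) (casimir lam mu z)"
    by (simp add: dser_square)
  also have "\<dots> = (invroot lam mu z)\<^sup>2 * (1 + fps_const (1/4) * casimir lam mu z)"
    by (simp add: fps_compose_mult_distrib fps_compose_add_distrib power2_eq_square invroot_def)
  finally show ?thesis by (simp add: one_plus_casimir)
qed

lemma alpha_beta_gamma: "(alpha lam mu z)\<^sup>2 + 2 * beta lam mu z * gamma lam mu z = 1"
proof -
  have "(alpha lam mu z)\<^sup>2 + 2 * beta lam mu z * gamma lam mu z
      = (invroot lam mu z)\<^sup>2 * ((genE lam mu z - 1)\<^sup>2 + 2 * genF lam mu z * genG lam mu z)"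
    by (simp add: alpha_def beta_def gamma_def power2_eq_square algebra_simps)
  then show ?thesis by (simp only: invroot_square)
qed

lemma casimir_has_deriv:
  assumes "fps_has_deriv (\<lambda>s. genE lam mu (\<zeta> s)) E' s" "fps_has_deriv (\<lambda>s. genF lam mu (\<zeta> s)) F' s"
    "fps_has_deriv (\<lambda>s. genG lam mu (\<zeta> s)) G' s"
  shows "fps_has_deriv (\<lambda>s. casimir lam mu (\<zeta> s))
    (8 * ((genE lam mu (\<zeta> s) - 1) * E' + genG lam mu (\<zeta> s) * F' + genF lam mu (\<zeta> s) * G')) s"
proof -
  have "fps_has_deriv (\<lambda>s. casimir lam mu (\<zeta> s))
     (0 * (genE lam mu (\<zeta> s) * genE lam mu (\<zeta> s) + 2 * (genF lam mu (\<zeta> s) * genG lam mu (\<zeta> s)))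
      + 4 * ((E' * genE lam mu (\<zeta> s) + genE lam mu (\<zeta> s) * E')
        + (0 * (genF lam mu (\<zeta> s) * genG lam mu (\<zeta> s))
           + 2 * (F' * genG lam mu (\<zeta> s) + genF lam mu (\<zeta> s) * G')))
      - (0 * genE lam mu (\<zeta> s) + 8 * E')) s"
    unfolding casimir_def
    by (intro fps_has_deriv_diff fps_has_deriv_mult fps_has_deriv_add fps_has_deriv_const assms)
  then show ?thesis by (simp add: algebra_simps)
qed

text \<open>As \<open>P\<close> has no constant term, only coefficients of index at most
  \<open>n\<close> of the powers of \<open>casimir\<close> enter, and those vanish for
  \<open>m > n\<close>; the truncated sum thus agrees with the full composition.\<close>

lemma sum_casimir_powers:
  assumes "fps_nth P 0 = 0"
  shows "(\<Sum>m=0..n. dd m * fps_nth (casimir lam mu z ^ m * P) (Suc n))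
     = fps_nth (invroot lam mu z * P) (Suc n)"
proof -
  have "(\<Sum>m=0..n. dd m * fps_nth (casimir lam mu z ^ m) i) * fps_nth P (Suc n - i)
      = fps_nth (invroot lam mu z) i * fps_nth P (Suc n - i)" if "i \<le> Suc n" for i
  proof (cases "i = Suc n")
    case False
    have "(\<Sum>m=0..n. dd m * fps_nth (casimir lam mu z ^ m) i)
        = (\<Sum>m=0..i. dd m * fps_nth (casimir lam mu z ^ m) i)"
      by (rule sum.mono_neutral_right) (use that False in \<open>auto simp: startsby_zero_power_prefix\<close>)
    then show ?thesis by (simp add: invroot_def fps_compose_nth dser_def)
  qed (simp add: assms)
  then have "(\<Sum>i=0..Suc n. (\<Sum>m=0..n. dd m * fps_nth (casimir lam mu z ^ m) i) * fps_nth P (Suc n - i))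
      = (\<Sum>i=0..Suc n. fps_nth (invroot lam mu z) i * fps_nth P (Suc n - i))"
    by (intro sum.cong) auto
  moreover have "(\<Sum>m=0..n. dd m * fps_nth (casimir lam mu z ^ m * P) (Suc n))
     = (\<Sum>i=0..Suc n. (\<Sum>m=0..n. dd m * fps_nth (casimir lam mu z ^ m) i) * fps_nth P (Suc n - i))"
    unfolding fps_mult_nth sum_distrib_left sum_distrib_right
    by (subst sum.swap) (simp only: mult.assoc)
  ultimately show ?thesis unfolding fps_mult_nth by simp
qed

text \<open>Chain rule: the power rule cancels the denominators \<open>m + 1\<close> and leaves
  \<open>invroot\<close> times the derivative of \<open>casimir\<close>. The constant is
  \<open>- 1/4\<close> times the 8 from \<open>casimir_has_deriv\<close>.\<close>

lemma Hn_has_deriv: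
  assumes "fps_has_deriv (\<lambda>s. genE lam mu (\<zeta> s)) E' s" "fps_has_deriv (\<lambda>s. genF lam mu (\<zeta> s)) F' s"
    "fps_has_deriv (\<lambda>s. genG lam mu (\<zeta> s)) G' s"
    and "fps_nth E' 0 = 0" "fps_nth F' 0 = 0" "fps_nth G' 0 = 0"
  shows "((\<lambda>s. Hn lam mu n (\<zeta> s)) has_real_derivative
     - 2 * fps_nth (alpha lam mu (\<zeta> s) * E' + gamma lam mu (\<zeta> s) * F' + beta lam mu (\<zeta> s) * G') (Suc n)) (at s)"
proof -
  define C' where "C' = 8 * ((genE lam mu (\<zeta> s) - 1) * E' + genG lam mu (\<zeta> s) * F' + genF lam mu (\<zeta> s) * G')"
  have C': "fps_has_deriv (\<lambda>s. casimir lam mu (\<zeta> s)) C' s"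
    unfolding C'_def by (rule casimir_has_deriv[OF assms(1-3)])
  have C0: "fps_nth C' 0 = 0" using assms(4-6) by (simp add: C'_def)
  have pw: "((\<lambda>s. fps_nth (casimir lam mu (\<zeta> s) ^ (m+1)) (n+1)) has_real_derivative
      real (m+1) * fps_nth (casimir lam mu (\<zeta> s) ^ m * C') (Suc n)) (at s)" for m
  proof -
    have "fps_nth (of_nat (m+1) * casimir lam mu (\<zeta> s) ^ (m+1-1) * C') (n+1)
        = real (m+1) * fps_nth (casimir lam mu (\<zeta> s) ^ m * C') (Suc n)"
      by (simp only: fps_of_nat[symmetric] mult.assoc fps_mult_left_const_nth) simp
    then show ?thesis
      using fps_has_deriv_power[OF C', of "m+1"] unfolding fps_has_deriv_def by metis
  qed
  have "((\<lambda>s. Hn lam mu n (\<zeta> s)) has_real_derivative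
      - 1/4 * (\<Sum>m=0..n. dd m / real (m+1) * (real (m+1) * fps_nth (casimir lam mu (\<zeta> s) ^ m * C') (Suc n)))) (at s)"
    unfolding Hn_eq by (intro DERIV_cmult DERIV_sum pw)
  also have "(\<Sum>m=0..n. dd m / real (m+1) * (real (m+1) * fps_nth (casimir lam mu (\<zeta> s) ^ m * C') (Suc n)))
      = (\<Sum>m=0..n. dd m * fps_nth (casimir lam mu (\<zeta> s) ^ m * C') (Suc n))"
    by (intro sum.cong) auto
  also have "\<dots> = fps_nth (invroot lam mu (\<zeta> s) * C') (Suc n)"
    by (rule sum_casimir_powers[OF C0])
  also have "invroot lam mu (\<zeta> s) * C'
      = 8 * (alpha lam mu (\<zeta> s) * E' + gamma lam mu (\<zeta> s) * F' + beta lam mu (\<zeta> s) * G')"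
    by (simp add: C'_def alpha_def beta_def gamma_def algebra_simps)
  finally show ?thesis
    unfolding numeral_mult_fps_nth by (rule DERIV_cong) (simp add: field_simps)
qed


section \<open>The Hamiltonian vector fields site by site\<close>

definition st_deriv :: "(real \<Rightarrow> 'n st) \<Rightarrow> 'n st \<Rightarrow> real \<Rightarrow> bool" where
  "st_deriv \<zeta> v s \<longleftrightarrow> (\<forall>i j. ((\<lambda>s. fst (\<zeta> s) i j) has_real_derivative fst v i j) (at s) \<and>
     ((\<lambda>s. snd (\<zeta> s) i j) has_real_derivative snd v i j) (at s))"

definition site_e :: "('n \<Rightarrow> real) \<Rightarrow> 'n st \<Rightarrow> 'n \<Rightarrow> real" where
  "site_e mu z j = mu j * (fst z I1 j * snd z I1 j - fst z I3 j * snd z I3 j)"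
definition site_f :: "('n \<Rightarrow> real) \<Rightarrow> 'n st \<Rightarrow> 'n \<Rightarrow> real" where
  "site_f mu z j = mu j * (fst z I1 j * snd z I2 j + fst z I2 j * snd z I3 j)"
definition site_g :: "('n \<Rightarrow> real) \<Rightarrow> 'n st \<Rightarrow> 'n \<Rightarrow> real" where
  "site_g mu z j = mu j * (fst z I2 j * snd z I1 j + fst z I3 j * snd z I2 j)"

lemma sum_sites:
  "ee lam mu k z = (\<Sum>j\<in>UNIV. lam j ^ k * site_e mu z j)"
  "ff lam mu k z = (\<Sum>j\<in>UNIV. lam j ^ k * site_f mu z j)"
  "gg lam mu k z = (\<Sum>j\<in>UNIV. lam j ^ k * site_g mu z j)"
  by (simp_all add: ee_def ff_def gg_def ipAB_def Pv_def Qv_def site_e_def site_f_def site_g_def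
      algebra_simps sum.distrib sum_subtractf)

definition dsite_e :: "('n \<Rightarrow> real) \<Rightarrow> 'n st \<Rightarrow> 'n st \<Rightarrow> 'n \<Rightarrow> real" where
  "dsite_e mu z v j = mu j * (fst v I1 j * snd z I1 j + fst z I1 j * snd v I1 j
      - fst v I3 j * snd z I3 j - fst z I3 j * snd v I3 j)"
definition dsite_f :: "('n \<Rightarrow> real) \<Rightarrow> 'n st \<Rightarrow> 'n st \<Rightarrow> 'n \<Rightarrow> real" where
  "dsite_f mu z v j = mu j * (fst v I1 j * snd z I2 j + fst z I1 j * snd v I2 j
      + fst v I2 j * snd z I3 j + fst z I2 j * snd v I3 j)"
definition dsite_g :: "('n \<Rightarrow> real) \<Rightarrow> 'n st \<Rightarrow> 'n st \<Rightarrow> 'n \<Rightarrow> real" where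
  "dsite_g mu z v j = mu j * (fst v I2 j * snd z I1 j + fst z I2 j * snd v I1 j
      + fst v I3 j * snd z I2 j + fst z I3 j * snd v I2 j)"

lemma sites_has_deriv:
  assumes "st_deriv \<zeta> v s"
  shows "((\<lambda>s. site_e mu (\<zeta> s) j) has_real_derivative dsite_e mu (\<zeta> s) v j) (at s)"
    "((\<lambda>s. site_f mu (\<zeta> s) j) has_real_derivative dsite_f mu (\<zeta> s) v j) (at s)"
    "((\<lambda>s. site_g mu (\<zeta> s) j) has_real_derivative dsite_g mu (\<zeta> s) v j) (at s)"
  unfolding site_e_def site_f_def site_g_def dsite_e_def dsite_f_def dsite_g_def
  by (rule derivative_eq_intros assms[unfolded st_deriv_def, rule_format, THEN conjunct1]
      assms[unfolded st_deriv_def, rule_format, THEN conjunct2] refl | simp add: algebra_simps)+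

lemma moments_has_deriv:
  assumes "st_deriv \<zeta> v s"
  shows "((\<lambda>s. ee lam mu k (\<zeta> s)) has_real_derivative (\<Sum>j\<in>UNIV. lam j ^ k * dsite_e mu (\<zeta> s) v j)) (at s)"
    "((\<lambda>s. ff lam mu k (\<zeta> s)) has_real_derivative (\<Sum>j\<in>UNIV. lam j ^ k * dsite_f mu (\<zeta> s) v j)) (at s)"
    "((\<lambda>s. gg lam mu k (\<zeta> s)) has_real_derivative (\<Sum>j\<in>UNIV. lam j ^ k * dsite_g mu (\<zeta> s) v j)) (at s)"
  unfolding sum_sites by (intro DERIV_sum DERIV_cmult sites_has_deriv assms)+

text \<open>With \<open>fps_X\<close> as the inverse of the spectral parameter zeta, this is the
  expansion of 1/(zeta - \<open>lam j\<close>); the generating series are sums of such simple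
  poles.\<close>

definition pole :: "('n \<Rightarrow> real) \<Rightarrow> 'n \<Rightarrow> real fps" where
  "pole lam j = fps_X * Abs_fps (\<lambda>k. lam j ^ k)"

lemma shift_sum_eq_poles:
  "fps_X * Abs_fps (\<lambda>k. \<Sum>j\<in>UNIV. lam j ^ k * u j) = (\<Sum>j\<in>(UNIV::'n::finite set). fps_const (u j) * pole lam j)"
  by (rule fps_ext) (simp add: pole_def fps_sum_nth mult.left_commute[of "fps_const _"] mult.commute sum.If_cases)

lemma gen_eq_poles:
  "genE lam mu z = (\<Sum>j\<in>UNIV. fps_const (site_e mu z j) * pole lam j)"
  "genF lam mu z = (\<Sum>j\<in>UNIV. fps_const (site_f mu z j) * pole lam j)"
  "genG lam mu z = (\<Sum>j\<in>UNIV. fps_const (site_g mu z j) * pole lam j)"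
  unfolding genE_def genF_def genG_def sum_sites shift_sum_eq_poles by simp_all

lemma gen_has_deriv:
  assumes "st_deriv \<zeta> v s"
  shows "fps_has_deriv (\<lambda>s. genE lam mu (\<zeta> s)) (\<Sum>j\<in>UNIV. fps_const (dsite_e mu (\<zeta> s) v j) * pole lam j) s"
    "fps_has_deriv (\<lambda>s. genF lam mu (\<zeta> s)) (\<Sum>j\<in>UNIV. fps_const (dsite_f mu (\<zeta> s) v j) * pole lam j) s"
    "fps_has_deriv (\<lambda>s. genG lam mu (\<zeta> s)) (\<Sum>j\<in>UNIV. fps_const (dsite_g mu (\<zeta> s) v j) * pole lam j) s"
  unfolding fps_has_deriv_def genE_def genF_def genG_def shift_sum_eq_poles[symmetric]
  by (auto simp: moments_has_deriv[OF assms])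

text \<open>The entries of the Lax matrix of the \<open>n\<close>-th flow, evaluated at the spectral parameter \<open>\<lambda>\<^sub>j\<close>:
  the polynomial part of \<open>\<lambda>\<^sup>n P\<close> for a series \<open>P\<close> in the inverse spectral parameter.\<close>

definition trunc :: "('n \<Rightarrow> real) \<Rightarrow> nat \<Rightarrow> real fps \<Rightarrow> 'n \<Rightarrow> real" where
  "trunc lam n P j = (\<Sum>l=0..n. fps_nth P l * lam j ^ (n - l))"

text \<open>Reading off one coefficient of \<open>P\<close> times a simple pole evaluates the
  polynomial part at that pole. This is how the gradient of \<open>Hn\<close> produces the truncated
  Lax entries.\<close>

lemma trunc_eq: "trunc lam n P j = fps_nth (P * pole lam j) (Suc n)"
proof -
  have "P * pole lam j = fps_X * (P * Abs_fps (\<lambda>k. lam j ^ k))"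
    by (simp add: pole_def mult.left_commute)
  then have "fps_nth (P * pole lam j) (Suc n) = fps_nth (P * Abs_fps (\<lambda>k. lam j ^ k)) n"
    by (simp only: fps_X_mult_nth) simp
  then show ?thesis by (simp add: fps_mult_nth trunc_def)
qed

lemma fps_nth_mult_poles:
  "fps_nth (P * (\<Sum>j\<in>(UNIV::'n::finite set). fps_const (u j) * pole lam j)) (Suc n)
    = (\<Sum>j\<in>UNIV. u j * trunc lam n P j)"
  by (simp add: sum_distrib_left fps_sum_nth trunc_eq mult.left_commute[of P])

lemma Hn_has_deriv_st:
  assumes "st_deriv \<zeta> v s"
  shows "((\<lambda>s. Hn lam mu n (\<zeta> s)) has_real_derivative
     - 2 * (\<Sum>j\<in>UNIV. dsite_e mu (\<zeta> s) v j * trunc lam n (alpha lam mu (\<zeta> s)) j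
        + dsite_f mu (\<zeta> s) v j * trunc lam n (gamma lam mu (\<zeta> s)) j
        + dsite_g mu (\<zeta> s) v j * trunc lam n (beta lam mu (\<zeta> s)) j)) (at s)"
proof -
  have z: "fps_nth (\<Sum>j\<in>UNIV. fps_const (u j) * pole lam j) 0 = 0" for u :: "'a \<Rightarrow> real"
    by (simp add: fps_sum_nth pole_def)
  show ?thesis
    using Hn_has_deriv[OF gen_has_deriv[OF assms], where n=n, OF z z z]
    by (simp only: fps_add_nth fps_nth_mult_poles sum.distrib)
qed

text \<open>The Hamiltonian vector fields are linear in each site \<open>j\<close>: it is the action of the traceless
  matrix with entries \<open>A j\<close>, \<open>B j\<close>, \<open>C j\<close> in the three-dimensional representation of \<open>sl\<^sub>2\<close> and
  its dual.\<close>

definition lax_field :: "('n \<Rightarrow> real) \<Rightarrow> ('n \<Rightarrow> real) \<Rightarrow> ('n \<Rightarrow> real) \<Rightarrow> 'n st \<Rightarrow> 'n st" where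
  "lax_field A B C z =
    ((\<lambda>i j. case i of
        I1 \<Rightarrow> 2 * (A j * fst z I1 j + B j * fst z I2 j)
      | I2 \<Rightarrow> 2 * (C j * fst z I1 j + B j * fst z I3 j)
      | I3 \<Rightarrow> 2 * (C j * fst z I2 j - A j * fst z I3 j)),
     (\<lambda>i j. case i of
        I1 \<Rightarrow> - 2 * (A j * snd z I1 j + C j * snd z I2 j)
      | I2 \<Rightarrow> - 2 * (B j * snd z I1 j + C j * snd z I3 j)
      | I3 \<Rightarrow> - 2 * (B j * snd z I2 j - A j * snd z I3 j)))"

definition akns_field :: "('n::finite \<Rightarrow> real) \<Rightarrow> ('n \<Rightarrow> real) \<Rightarrow> nat \<Rightarrow> 'n st \<Rightarrow> 'n st" where
  "akns_field lam mu n z = lax_field (trunc lam n (alpha lam mu z)) (trunc lam n (beta lam mu z))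
     (trunc lam n (gamma lam mu z)) z"

lemma sum_eq_single:
  fixes u :: "'n::finite \<Rightarrow> real"
  assumes "\<And>j'. j' \<noteq> j \<Longrightarrow> u j' = 0"
  shows "(\<Sum>j'\<in>UNIV. u j') = u j"
  using sum.mono_neutral_right[of UNIV "{j}" u] assms by auto

text \<open>Along a coordinate line only site \<open>j\<close> moves, so the sum over sites
  collapses. The factor \<open>mu j\<close>, here and in \<open>dphi_Hn\<close>, is cancelled by
  \<open>1 / mu j\<close> in \<open>ham_sol\<close>.\<close>

lemma dpsi_Hn:
  "dpsi (Hn lam mu n) z i j = - mu j * fst (akns_field lam mu n z) i j"
proof -
  define v :: "'a st" where "v = (\<lambda>_ _. 0, \<lambda>i' j'. if i' = i \<and> j' = j then 1 else 0)"
  define \<zeta> where "\<zeta> s = (fst z, (snd z)(i := (snd z i)(j := snd z i j + s)))" for s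
  have \<zeta>0: "\<zeta> 0 = z" by (simp add: \<zeta>_def)
  have "st_deriv \<zeta> v 0"
    unfolding st_deriv_def
  proof (intro allI conjI)
    fix i' j'
    show "((\<lambda>s. fst (\<zeta> s) i' j') has_real_derivative fst v i' j') (at 0)"
      "((\<lambda>s. snd (\<zeta> s) i' j') has_real_derivative snd v i' j') (at 0)"
      by (cases "i' = i"; cases "j' = j"; auto simp: v_def \<zeta>_def intro!: derivative_eq_intros)+
  qed
  from Hn_has_deriv_st[OF this, of lam mu n, unfolded \<zeta>0]
  have "dpsi (Hn lam mu n) z i j = - 2 * (\<Sum>j\<in>UNIV. dsite_e mu z v j * trunc lam n (alpha lam mu z) j
        + dsite_f mu z v j * trunc lam n (gamma lam mu z) j
        + dsite_g mu z v j * trunc lam n (beta lam mu z) j)"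
    unfolding dpsi_def \<zeta>_def by (rule DERIV_imp_deriv)
  also have "\<dots> = - 2 * (dsite_e mu z v j * trunc lam n (alpha lam mu z) j
        + dsite_f mu z v j * trunc lam n (gamma lam mu z) j
        + dsite_g mu z v j * trunc lam n (beta lam mu z) j)"
    by (subst sum_eq_single[of j]) (auto simp: v_def dsite_e_def dsite_f_def dsite_g_def)
  also have "\<dots> = - mu j * fst (akns_field lam mu n z) i j"
    by (cases i) (simp_all add: v_def dsite_e_def dsite_f_def dsite_g_def akns_field_def lax_field_def algebra_simps)
  finally show ?thesis .
qed

lemma dphi_Hn:
  "dphi (Hn lam mu n) z i j = mu j * snd (akns_field lam mu n z) i j"
proof -
  define v :: "'a st" where "v = (\<lambda>i' j'. if i' = i \<and> j' = j then 1 else 0, \<lambda>_ _. 0)"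
  define \<zeta> where "\<zeta> s = ((fst z)(i := (fst z i)(j := fst z i j + s)), snd z)" for s
  have \<zeta>0: "\<zeta> 0 = z" by (simp add: \<zeta>_def)
  have "st_deriv \<zeta> v 0"
    unfolding st_deriv_def
  proof (intro allI conjI)
    fix i' j'
    show "((\<lambda>s. fst (\<zeta> s) i' j') has_real_derivative fst v i' j') (at 0)"
      "((\<lambda>s. snd (\<zeta> s) i' j') has_real_derivative snd v i' j') (at 0)"
      by (cases "i' = i"; cases "j' = j"; auto simp: v_def \<zeta>_def intro!: derivative_eq_intros)+
  qed
  from Hn_has_deriv_st[OF this, of lam mu n, unfolded \<zeta>0]
  have "dphi (Hn lam mu n) z i j = - 2 * (\<Sum>j\<in>UNIV. dsite_e mu z v j * trunc lam n (alpha lam mu z) j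
        + dsite_f mu z v j * trunc lam n (gamma lam mu z) j
        + dsite_g mu z v j * trunc lam n (beta lam mu z) j)"
    unfolding dphi_def \<zeta>_def by (rule DERIV_imp_deriv)
  also have "\<dots> = - 2 * (dsite_e mu z v j * trunc lam n (alpha lam mu z) j
        + dsite_f mu z v j * trunc lam n (gamma lam mu z) j
        + dsite_g mu z v j * trunc lam n (beta lam mu z) j)"
    by (subst sum_eq_single[of j]) (auto simp: v_def dsite_e_def dsite_f_def dsite_g_def)
  also have "\<dots> = mu j * snd (akns_field lam mu n z) i j"
    by (cases i) (simp_all add: v_def dsite_e_def dsite_f_def dsite_g_def akns_field_def lax_field_def algebra_simps)
  finally show ?thesis .
qed

lemma ham_sol_Hn:
  assumes "ham_sol mu (Hn lam mu n) \<zeta> Y" "\<forall>j. mu j \<noteq> 0" "y \<in> Y"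
  shows "st_deriv \<zeta> (akns_field lam mu n (\<zeta> y)) y"
  using assms unfolding ham_sol_def st_deriv_def dpsi_Hn dphi_Hn by simp

text \<open>Lets one analysis serve both flows. The squares of \<open>ee lam mu 0 z\<close> from
  \<open>FF\<close> at 2 and from the square of \<open>FF\<close> at 1 cancel.\<close>

lemma Hx_eq_H1: "Hx lam mu = Hn lam mu 1"
proof
  fix z
  have "fps_nth (casimir lam mu z ^ 2) 2 = (FF lam mu 1 z)\<^sup>2"
    by (simp add: power2_eq_square fps_mult_nth FF_eq_casimir numeral_2_eq_2)
  moreover have "fps_nth (casimir lam mu z) 2 = FF lam mu 2 z" by (simp add: FF_eq_casimir)
  ultimately show "Hx lam mu z = Hn lam mu 1 z"
    by (simp add: Hx_def Hn_eq numeral_2_eq_2[symmetric] dd_small FF_def power2_eq_square algebra_simps)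
qed

text \<open>Initial data for the comparison with the AKNS sequence. In \<open>alpha\<close> the
  degree 1 terms of \<open>genE\<close> and of \<open>invroot\<close> cancel.\<close>

lemma low_coefficients:
  "fps_nth (alpha lam mu z) 0 = - 1" "fps_nth (alpha lam mu z) (Suc 0) = 0"
  "fps_nth (beta lam mu z) 0 = 0" "fps_nth (beta lam mu z) (Suc 0) = ff lam mu 0 z"
  "fps_nth (gamma lam mu z) 0 = 0" "fps_nth (gamma lam mu z) (Suc 0) = gg lam mu 0 z"
proof -
  have r0: "fps_nth (invroot lam mu z) 0 = 1"
    by (simp add: invroot_def dser_def dd_small)
  have r1: "fps_nth (invroot lam mu z) (Suc 0) = ee lam mu 0 z"
    using FF_eq_casimir[of 1 lam mu z, symmetric]
    by (simp add: invroot_def fps_compose_nth dser_def dd_small FF_def)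
  show "fps_nth (alpha lam mu z) 0 = - 1" "fps_nth (alpha lam mu z) (Suc 0) = 0"
    "fps_nth (beta lam mu z) 0 = 0" "fps_nth (beta lam mu z) (Suc 0) = ff lam mu 0 z"
    "fps_nth (gamma lam mu z) 0 = 0" "fps_nth (gamma lam mu z) (Suc 0) = gg lam mu 0 z"
    by (simp_all add: alpha_def beta_def gamma_def r0 r1 genE_def genF_def genG_def)
qed

lemma akns_field_1:
  "akns_field lam mu 1 z = lax_field (\<lambda>j. - lam j) (\<lambda>_. ff lam mu 0 z) (\<lambda>_. gg lam mu 0 z) z"
  by (simp add: akns_field_def trunc_def[abs_def] low_coefficients)

text \<open>With off-diagonal entries scaled by \<open>sqrt 2\<close>, this is the commutator of the
  Lax matrix with the traceless matrix formed by the site quantities; the same scaling appears in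
  \<open>q\<close> and \<open>r\<close>.\<close>

lemma dsite_lax_field:
  "dsite_e mu z (lax_field A B C z) j = 2 * B j * site_g mu z j - 2 * C j * site_f mu z j"
  "dsite_f mu z (lax_field A B C z) j = 2 * A j * site_f mu z j - 2 * B j * site_e mu z j"
  "dsite_g mu z (lax_field A B C z) j = 2 * C j * site_e mu z j - 2 * A j * site_g mu z j"
  by (simp_all add: dsite_e_def dsite_f_def dsite_g_def lax_field_def site_e_def site_f_def site_g_def
      algebra_simps)

text \<open>Summing the commutators over the sites gives coefficients of products of normalised with
  unnormalised series. The quadratic parts cancel, and only the \<open>- 1\<close> in
  \<open>alpha\<close> contributes.\<close>

lemma t_flow_moments:
  assumes "st_deriv \<zeta> (akns_field lam mu n (\<zeta> s)) s"
  shows "((\<lambda>s. ff lam mu 0 (\<zeta> s)) has_real_derivative - 2 * fps_nth (beta lam mu (\<zeta> s)) (Suc n)) (at s)"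
    "((\<lambda>s. gg lam mu 0 (\<zeta> s)) has_real_derivative 2 * fps_nth (gamma lam mu (\<zeta> s)) (Suc n)) (at s)"
proof -
  define z where "z = \<zeta> s"
  have "(\<Sum>j\<in>UNIV. lam j ^ 0 * dsite_f mu z (akns_field lam mu n z) j)
      = 2 * fps_nth (alpha lam mu z * genF lam mu z) (Suc n) - 2 * fps_nth (beta lam mu z * genE lam mu z) (Suc n)"
    unfolding gen_eq_poles fps_nth_mult_poles
    by (simp add: akns_field_def dsite_lax_field sum_subtractf sum_distrib_left mult_ac)
  also have "\<dots> = 2 * fps_nth (alpha lam mu z * genF lam mu z - beta lam mu z * genE lam mu z) (Suc n)"
    by simp
  also have "alpha lam mu z * genF lam mu z - beta lam mu z * genE lam mu z = - beta lam mu z"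
    by (simp add: alpha_def beta_def algebra_simps)
  finally show "((\<lambda>s. ff lam mu 0 (\<zeta> s)) has_real_derivative - 2 * fps_nth (beta lam mu (\<zeta> s)) (Suc n)) (at s)"
    using moments_has_deriv(2)[OF assms, of lam mu 0] by (simp add: z_def)
  have "(\<Sum>j\<in>UNIV. lam j ^ 0 * dsite_g mu z (akns_field lam mu n z) j)
      = 2 * fps_nth (gamma lam mu z * genE lam mu z) (Suc n) - 2 * fps_nth (alpha lam mu z * genG lam mu z) (Suc n)"
    unfolding gen_eq_poles fps_nth_mult_poles
    by (simp add: akns_field_def dsite_lax_field sum_subtractf sum_distrib_left mult_ac)
  also have "\<dots> = 2 * fps_nth (gamma lam mu z * genE lam mu z - alpha lam mu z * genG lam mu z) (Suc n)"
    by simp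
  also have "gamma lam mu z * genE lam mu z - alpha lam mu z * genG lam mu z = gamma lam mu z"
    by (simp add: alpha_def gamma_def algebra_simps)
  finally show "((\<lambda>s. gg lam mu 0 (\<zeta> s)) has_real_derivative 2 * fps_nth (gamma lam mu (\<zeta> s)) (Suc n)) (at s)"
    using moments_has_deriv(3)[OF assms, of lam mu 0] by (simp add: z_def)
qed

text \<open>Along the \<open>x\<close>-flow the Casimir series is constant, so the normalised series satisfy the same
  linear equations as the unnormalised ones.\<close>

lemma x_flow_coefficients:
  fixes lam mu :: "'n::finite \<Rightarrow> real"
  assumes "st_deriv \<zeta> (akns_field lam mu 1 (\<zeta> s)) s"
  shows "((\<lambda>s. fps_nth (alpha lam mu (\<zeta> s)) i) has_real_derivative
      2 * ff lam mu 0 (\<zeta> s) * fps_nth (gamma lam mu (\<zeta> s)) i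
      - 2 * gg lam mu 0 (\<zeta> s) * fps_nth (beta lam mu (\<zeta> s)) i) (at s)"
    "((\<lambda>s. fps_nth (beta lam mu (\<zeta> s)) i) has_real_derivative
      - 2 * fps_nth (beta lam mu (\<zeta> s)) (Suc i)
      - 2 * ff lam mu 0 (\<zeta> s) * fps_nth (alpha lam mu (\<zeta> s)) i) (at s)"
    "((\<lambda>s. fps_nth (gamma lam mu (\<zeta> s)) i) has_real_derivative
      2 * fps_nth (gamma lam mu (\<zeta> s)) (Suc i)
      + 2 * gg lam mu 0 (\<zeta> s) * fps_nth (alpha lam mu (\<zeta> s)) i) (at s)"
proof -
  define z where "z = \<zeta> s"
  define f0 g0 where "f0 = fps_const (ff lam mu 0 z)" "g0 = fps_const (gg lam mu 0 z)"
  let ?R = "invroot lam mu z" and ?E = "genE lam mu z" and ?F = "genF lam mu z" and ?G = "genG lam mu z"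
  define E' F' G' where
    "E' = fps_X * Abs_fps (\<lambda>k. \<Sum>j\<in>UNIV. lam j ^ k * dsite_e mu z (akns_field lam mu 1 z) j)"
    "F' = fps_X * Abs_fps (\<lambda>k. \<Sum>j\<in>UNIV. lam j ^ k * dsite_f mu z (akns_field lam mu 1 z) j)"
    "G' = fps_X * Abs_fps (\<lambda>k. \<Sum>j\<in>UNIV. lam j ^ k * dsite_g mu z (akns_field lam mu 1 z) j)"
  have d: "fps_has_deriv (\<lambda>s. genE lam mu (\<zeta> s)) E' s" "fps_has_deriv (\<lambda>s. genF lam mu (\<zeta> s)) F' s"
    "fps_has_deriv (\<lambda>s. genG lam mu (\<zeta> s)) G' s"
    using gen_has_deriv[OF assms, of lam mu] unfolding E'_F'_G'_def shift_sum_eq_poles z_def by auto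
  \<comment> \<open>The diagonal entry \<open>- lam j\<close> raises the moment index by
    one.\<close>
  have e: "(\<Sum>j\<in>UNIV. lam j ^ k * dsite_e mu z (akns_field lam mu 1 z) j)
      = 2 * ff lam mu 0 z * gg lam mu k z - 2 * gg lam mu 0 z * ff lam mu k z"
    "(\<Sum>j\<in>UNIV. lam j ^ k * dsite_f mu z (akns_field lam mu 1 z) j)
      = - 2 * ff lam mu (Suc k) z - 2 * ff lam mu 0 z * ee lam mu k z"
    "(\<Sum>j\<in>UNIV. lam j ^ k * dsite_g mu z (akns_field lam mu 1 z) j)
      = 2 * gg lam mu (Suc k) z + 2 * gg lam mu 0 z * ee lam mu k z" for k
    unfolding akns_field_1 dsite_lax_field sum_sites(1)[of lam mu k] sum_sites(2)[of lam mu k]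
      sum_sites(3)[of lam mu k] sum_sites(2)[of lam mu "Suc k"] sum_sites(3)[of lam mu "Suc k"]
    by (simp_all add: sum_distrib_left sum_subtractf[symmetric] sum.distrib[symmetric] algebra_simps)
  have E': "E' = 2 * f0 * ?G - 2 * g0 * ?F"
    unfolding E'_F'_G'_def e
    by (rule fps_ext) (simp add: f0_g0_def genF_def genG_def mult.assoc numeral_mult_fps_nth)
  \<comment> \<open>The factor \<open>fps_X\<close> compensates the raised moment index. In degree 1
    the \<open>- 1\<close> next to \<open>?E\<close> cancels the lowest moment, which the raised
    index never produces.\<close>
  have F': "fps_X * F' = - 2 * ?F - 2 * fps_X * f0 * (?E - 1)"
    unfolding E'_F'_G'_def e f0_g0_def genE_def genF_def
  proof (rule fps_ext, goal_cases)
    case (1 n)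
    consider "n = 0" | "n = 1" | m where "n = Suc (Suc m)" by (metis One_nat_def not0_implies_Suc)
    then show ?case by cases (simp_all add: mult.assoc numeral_mult_fps_nth)
  qed
  have G': "fps_X * G' = 2 * ?G + 2 * fps_X * g0 * (?E - 1)"
    unfolding E'_F'_G'_def e f0_g0_def genE_def genG_def
  proof (rule fps_ext, goal_cases)
    case (1 n)
    consider "n = 0" | "n = 1" | m where "n = Suc (Suc m)" by (metis One_nat_def not0_implies_Suc)
    then show ?case by cases (simp_all add: mult.assoc numeral_mult_fps_nth)
  qed
  \<comment> \<open>Up to \<open>fps_X\<close> this is the derivative of \<open>casimir\<close>;
    inserting the three commutator equations makes everything cancel.\<close>
  have "fps_X * (8 * ((?E - 1) * E' + ?G * F' + ?F * G')) = 8 * ((?E - 1) * fps_X * E' + ?G * (fps_X * F') + ?F * (fps_X * G'))"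
    by (simp add: algebra_simps)
  also have "\<dots> = 0" unfolding E' F' G' by (simp add: algebra_simps)
  finally have "8 * ((?E - 1) * E' + ?G * F' + ?F * G') = 0" by simp
  then have C': "fps_has_deriv (\<lambda>s. casimir lam mu (\<zeta> s)) 0 s"
    using casimir_has_deriv[OF d] by (simp add: z_def)
  have R': "fps_has_deriv (\<lambda>s. invroot lam mu (\<zeta> s)) 0 s"
    unfolding fps_has_deriv_def
  proof
    fix k
    have "((\<lambda>s. \<Sum>i=0..k. fps_nth dser i * fps_nth (casimir lam mu (\<zeta> s) ^ i) k) has_real_derivative
        (\<Sum>i=0..k. fps_nth dser i * fps_nth 0 k)) (at s)"
      using fps_has_deriv_power[OF C'] unfolding fps_has_deriv_def
      by (intro DERIV_sum DERIV_cmult) simp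
    then show "((\<lambda>s. fps_nth (invroot lam mu (\<zeta> s)) k) has_real_derivative fps_nth 0 k) (at s)"
      by (simp add: invroot_def fps_compose_nth)
  qed
  have a': "fps_has_deriv (\<lambda>s. alpha lam mu (\<zeta> s)) (?R * E') s"
    using fps_has_deriv_mult[OF R' fps_has_deriv_diff[OF d(1) fps_has_deriv_const[of 1]]]
    by (simp add: alpha_def z_def)
  have b': "fps_has_deriv (\<lambda>s. beta lam mu (\<zeta> s)) (?R * F') s"
    using fps_has_deriv_mult[OF R' d(2)] by (simp add: beta_def z_def)
  have c': "fps_has_deriv (\<lambda>s. gamma lam mu (\<zeta> s)) (?R * G') s"
    using fps_has_deriv_mult[OF R' d(3)] by (simp add: gamma_def z_def)
  have "?R * E' = 2 * (f0 * gamma lam mu z) - 2 * (g0 * beta lam mu z)"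
    unfolding E' by (simp add: beta_def gamma_def algebra_simps)
  then have "fps_nth (?R * E') i = 2 * ff lam mu 0 z * fps_nth (gamma lam mu z) i
      - 2 * gg lam mu 0 z * fps_nth (beta lam mu z) i"
    by (simp add: f0_g0_def numeral_mult_fps_nth)
  then show "((\<lambda>s. fps_nth (alpha lam mu (\<zeta> s)) i) has_real_derivative
      2 * ff lam mu 0 (\<zeta> s) * fps_nth (gamma lam mu (\<zeta> s)) i
      - 2 * gg lam mu 0 (\<zeta> s) * fps_nth (beta lam mu (\<zeta> s)) i) (at s)"
    using a' unfolding fps_has_deriv_def z_def by metis
  have "fps_X * (?R * F') = ?R * (fps_X * F')" by (simp add: algebra_simps)
  also have "\<dots> = - 2 * beta lam mu z - 2 * (fps_X * (f0 * alpha lam mu z))"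
    unfolding F' by (simp add: alpha_def beta_def algebra_simps)
  finally have "fps_nth (fps_X * (?R * F')) (Suc i)
      = fps_nth (- 2 * beta lam mu z - 2 * (fps_X * (f0 * alpha lam mu z))) (Suc i)" by simp
  then have "fps_nth (?R * F') i = - 2 * fps_nth (beta lam mu z) (Suc i)
      - 2 * ff lam mu 0 z * fps_nth (alpha lam mu z) i"
    by (simp add: f0_g0_def numeral_mult_fps_nth)
  then show "((\<lambda>s. fps_nth (beta lam mu (\<zeta> s)) i) has_real_derivative
      - 2 * fps_nth (beta lam mu (\<zeta> s)) (Suc i)
      - 2 * ff lam mu 0 (\<zeta> s) * fps_nth (alpha lam mu (\<zeta> s)) i) (at s)"
    using b' unfolding fps_has_deriv_def z_def by metis
  have "fps_X * (?R * G') = ?R * (fps_X * G')" by (simp add: algebra_simps)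
  also have "\<dots> = 2 * gamma lam mu z + 2 * (fps_X * (g0 * alpha lam mu z))"
    unfolding G' by (simp add: alpha_def gamma_def algebra_simps)
  finally have "fps_nth (fps_X * (?R * G')) (Suc i)
      = fps_nth (2 * gamma lam mu z + 2 * (fps_X * (g0 * alpha lam mu z))) (Suc i)" by simp
  then have "fps_nth (?R * G') i = 2 * fps_nth (gamma lam mu z) (Suc i)
      + 2 * gg lam mu 0 z * fps_nth (alpha lam mu z) i"
    by (simp add: f0_g0_def numeral_mult_fps_nth)
  then show "((\<lambda>s. fps_nth (gamma lam mu (\<zeta> s)) i) has_real_derivative
      2 * fps_nth (gamma lam mu (\<zeta> s)) (Suc i)
      + 2 * gg lam mu 0 (\<zeta> s) * fps_nth (alpha lam mu (\<zeta> s)) i) (at s)"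
    using c' unfolding fps_has_deriv_def z_def by metis
qed

section \<open>Zero curvature and the AKNS recursion\<close>

lemma lax_field_has_deriv:
  assumes "st_deriv \<zeta> v s"
    and "\<And>j. ((\<lambda>s. A s j) has_real_derivative A' j) (at s)"
    and "\<And>j. ((\<lambda>s. B s j) has_real_derivative B' j) (at s)"
    and "\<And>j. ((\<lambda>s. C s j) has_real_derivative C' j) (at s)"
  shows "st_deriv (\<lambda>s. lax_field (A s) (B s) (C s) (\<zeta> s))
     (\<lambda>i j. fst (lax_field A' B' C' (\<zeta> s)) i j + fst (lax_field (A s) (B s) (C s) v) i j,
      \<lambda>i j. snd (lax_field A' B' C' (\<zeta> s)) i j + snd (lax_field (A s) (B s) (C s) v) i j) s"
  unfolding st_deriv_def
proof (intro allI conjI)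
  note d = assms(1)[unfolded st_deriv_def, rule_format, THEN conjunct1]
    assms(1)[unfolded st_deriv_def, rule_format, THEN conjunct2]
  fix i j
  show "((\<lambda>s. fst (lax_field (A s) (B s) (C s) (\<zeta> s)) i j) has_real_derivative
      fst (\<lambda>i j. fst (lax_field A' B' C' (\<zeta> s)) i j + fst (lax_field (A s) (B s) (C s) v) i j,
      \<lambda>i j. snd (lax_field A' B' C' (\<zeta> s)) i j + snd (lax_field (A s) (B s) (C s) v) i j) i j) (at s)"
    by (cases i; simp add: lax_field_def;
        (rule derivative_eq_intros d assms refl | simp add: algebra_simps)+)
  show "((\<lambda>s. snd (lax_field (A s) (B s) (C s) (\<zeta> s)) i j) has_real_derivative
      snd (\<lambda>i j. fst (lax_field A' B' C' (\<zeta> s)) i j + fst (lax_field (A s) (B s) (C s) v) i j,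
      \<lambda>i j. snd (lax_field A' B' C' (\<zeta> s)) i j + snd (lax_field (A s) (B s) (C s) v) i j) i j) (at s)"
    by (cases i; simp add: lax_field_def;
        (rule derivative_eq_intros d assms refl | simp add: algebra_simps)+)
qed

text \<open>Raising the coefficient index is multiplication by the spectral parameter, up to one
  leftover coefficient of index \<open>Suc n\<close>.\<close>

lemma trunc_shift:
  assumes "fps_nth P 0 = 0"
  shows "(\<Sum>l=0..n. fps_nth P (Suc l) * lam j ^ (n - l)) = lam j * trunc lam n P j + fps_nth P (Suc n)"
proof -
  have "(\<Sum>l=0..Suc n. fps_nth P l * lam j ^ (Suc n - l))
      = (\<Sum>l=0..n. fps_nth P (Suc l) * lam j ^ (n - l))"
    using assms by (subst sum.atLeast0_atMost_Suc_shift) simp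
  moreover have "(\<Sum>l=0..Suc n. fps_nth P l * lam j ^ (Suc n - l))
      = lam j * trunc lam n P j + fps_nth P (Suc n)"
    by (simp add: trunc_def sum_distrib_left Suc_diff_le mult_ac)
  ultimately show ?thesis by simp
qed

text \<open>The leftover coefficients of index \<open>Suc n\<close> enter exactly as the
  \<open>t\<close>-velocities of \<open>ff\<close> and \<open>gg\<close> at 0 from
  \<open>t_flow_moments\<close>, so these are the entries of the zero curvature equation.\<close>

lemma x_flow_trunc:
  assumes "st_deriv \<zeta> (akns_field lam mu 1 (\<zeta> s)) s"
  shows "((\<lambda>s. trunc lam n (alpha lam mu (\<zeta> s)) j) has_real_derivative
      2 * ff lam mu 0 (\<zeta> s) * trunc lam n (gamma lam mu (\<zeta> s)) j
      - 2 * gg lam mu 0 (\<zeta> s) * trunc lam n (beta lam mu (\<zeta> s)) j) (at s)"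
    "((\<lambda>s. trunc lam n (beta lam mu (\<zeta> s)) j) has_real_derivative
      - 2 * (lam j * trunc lam n (beta lam mu (\<zeta> s)) j + fps_nth (beta lam mu (\<zeta> s)) (Suc n))
      - 2 * ff lam mu 0 (\<zeta> s) * trunc lam n (alpha lam mu (\<zeta> s)) j) (at s)"
    "((\<lambda>s. trunc lam n (gamma lam mu (\<zeta> s)) j) has_real_derivative
      2 * (lam j * trunc lam n (gamma lam mu (\<zeta> s)) j + fps_nth (gamma lam mu (\<zeta> s)) (Suc n))
      + 2 * gg lam mu 0 (\<zeta> s) * trunc lam n (alpha lam mu (\<zeta> s)) j) (at s)"
proof -
  note c = x_flow_coefficients[OF assms]
  have d: "((\<lambda>s. trunc lam n (P s) j) has_real_derivative (\<Sum>l=0..n. P' l * lam j ^ (n - l))) (at s)"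
    if "\<And>l. ((\<lambda>s. fps_nth (P s) l) has_real_derivative P' l) (at s)" for P P'
    unfolding trunc_def by (intro DERIV_sum DERIV_cmult_right that)
  show "((\<lambda>s. trunc lam n (alpha lam mu (\<zeta> s)) j) has_real_derivative
      2 * ff lam mu 0 (\<zeta> s) * trunc lam n (gamma lam mu (\<zeta> s)) j
      - 2 * gg lam mu 0 (\<zeta> s) * trunc lam n (beta lam mu (\<zeta> s)) j) (at s)"
    by (rule DERIV_cong[OF d[OF c(1)]])
      (simp add: trunc_def sum_subtractf left_diff_distrib sum_distrib_left mult.assoc)
  show "((\<lambda>s. trunc lam n (beta lam mu (\<zeta> s)) j) has_real_derivative
      - 2 * (lam j * trunc lam n (beta lam mu (\<zeta> s)) j + fps_nth (beta lam mu (\<zeta> s)) (Suc n))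
      - 2 * ff lam mu 0 (\<zeta> s) * trunc lam n (alpha lam mu (\<zeta> s)) j) (at s)"
    unfolding trunc_shift[OF low_coefficients(3), symmetric]
    by (rule DERIV_cong[OF d[OF c(2)]])
      (simp add: trunc_def sum_subtractf left_diff_distrib sum_distrib_left sum_negf mult.assoc)
  show "((\<lambda>s. trunc lam n (gamma lam mu (\<zeta> s)) j) has_real_derivative
      2 * (lam j * trunc lam n (gamma lam mu (\<zeta> s)) j + fps_nth (gamma lam mu (\<zeta> s)) (Suc n))
      + 2 * gg lam mu 0 (\<zeta> s) * trunc lam n (alpha lam mu (\<zeta> s)) j) (at s)"
    unfolding trunc_shift[OF low_coefficients(5), symmetric]
    by (rule DERIV_cong[OF d[OF c(3)]])
      (simp add: trunc_def sum.distrib distrib_right sum_distrib_left mult.assoc)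
qed

text \<open>Both fields are a matrix depending on the state, U for \<open>x\<close> and V for
  \<open>t\<close>, applied to the state \<open>z\<close>. The mixed derivatives are U_t z + U V z
  and V_x z + V U z, and zero curvature makes them equal.\<close>

lemma akns_fields_commute:
  fixes lam mu :: "'n::finite \<Rightarrow> real"
  assumes t: "st_deriv \<zeta> (akns_field lam mu n z) s" "\<zeta> s = z"
    and x: "st_deriv \<xi> (akns_field lam mu 1 z) s" "\<xi> s = z"
  shows "\<exists>w. st_deriv (\<lambda>s. akns_field lam mu 1 (\<zeta> s)) w s \<and> st_deriv (\<lambda>s. akns_field lam mu n (\<xi> s)) w s"
proof -
  let ?a = "trunc lam n (alpha lam mu z)" and ?b = "trunc lam n (beta lam mu z)"
    and ?c = "trunc lam n (gamma lam mu z)" and ?f = "ff lam mu 0 z" and ?g = "gg lam mu 0 z"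
    and ?fx = "akns_field lam mu 1 z" and ?ft = "akns_field lam mu n z"
  let ?b1 = "fps_nth (beta lam mu z) (Suc n)" and ?c1 = "fps_nth (gamma lam mu z) (Suc n)"
  \<comment> \<open>\<open>w\<close> is U_t z + U V z; the diagonal of U is constant, hence the zero
    entry.\<close>
  define w where "w =
    ((\<lambda>i j. fst (lax_field (\<lambda>_. 0) (\<lambda>_. - 2 * ?b1) (\<lambda>_. 2 * ?c1) z) i j
        + fst (lax_field (\<lambda>j. - lam j) (\<lambda>_. ?f) (\<lambda>_. ?g) ?ft) i j),
     (\<lambda>i j. snd (lax_field (\<lambda>_. 0) (\<lambda>_. - 2 * ?b1) (\<lambda>_. 2 * ?c1) z) i j
        + snd (lax_field (\<lambda>j. - lam j) (\<lambda>_. ?f) (\<lambda>_. ?g) ?ft) i j))"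
  have 1: "st_deriv (\<lambda>s. akns_field lam mu 1 (\<zeta> s)) w s"
    unfolding akns_field_1 w_def
    using lax_field_has_deriv[OF t(1), of "\<lambda>_ j. - lam j" "\<lambda>_. 0" "\<lambda>s _. ff lam mu 0 (\<zeta> s)" "\<lambda>_. - 2 * ?b1"
        "\<lambda>s _. gg lam mu 0 (\<zeta> s)" "\<lambda>_. 2 * ?c1"]
      t_flow_moments[of \<zeta> lam mu n s] t
    by simp
  define a' b' c' where "a' j = 2 * ?f * ?c j - 2 * ?g * ?b j"
    "b' j = - 2 * (lam j * ?b j + ?b1) - 2 * ?f * ?a j"
    "c' j = 2 * (lam j * ?c j + ?c1) + 2 * ?g * ?a j" for j
  have 2: "st_deriv (\<lambda>s. akns_field lam mu n (\<xi> s))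
     (\<lambda>i j. fst (lax_field a' b' c' z) i j + fst (lax_field ?a ?b ?c ?fx) i j,
      \<lambda>i j. snd (lax_field a' b' c' z) i j + snd (lax_field ?a ?b ?c ?fx) i j) s"
    using lax_field_has_deriv[OF x(1), of "\<lambda>s. trunc lam n (alpha lam mu (\<xi> s))" a'
        "\<lambda>s. trunc lam n (beta lam mu (\<xi> s))" b' "\<lambda>s. trunc lam n (gamma lam mu (\<xi> s))" c']
      x_flow_trunc[of \<xi> lam mu s n] x
    unfolding akns_field_def[of lam mu n] a'_b'_c'_def by simp
  have "(\<lambda>i j. fst (lax_field a' b' c' z) i j + fst (lax_field ?a ?b ?c ?fx) i j,
      \<lambda>i j. snd (lax_field a' b' c' z) i j + snd (lax_field ?a ?b ?c ?fx) i j) = w"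
    unfolding w_def prod.inject fun_eq_iff
  proof (intro conjI allI)
    fix i j
    show "fst (lax_field a' b' c' z) i j + fst (lax_field ?a ?b ?c ?fx) i j
        = fst (lax_field (\<lambda>_. 0) (\<lambda>_. - 2 * ?b1) (\<lambda>_. 2 * ?c1) z) i j
        + fst (lax_field (\<lambda>j. - lam j) (\<lambda>_. ?f) (\<lambda>_. ?g) ?ft) i j"
      by (cases i) (simp_all only: akns_field_1 akns_field_def[of lam mu n] lax_field_def a'_b'_c'_def fst_conv
          snd_conv idx.case, simp_all add: algebra_simps)
    show "snd (lax_field a' b' c' z) i j + snd (lax_field ?a ?b ?c ?fx) i j
        = snd (lax_field (\<lambda>_. 0) (\<lambda>_. - 2 * ?b1) (\<lambda>_. 2 * ?c1) z) i j
        + snd (lax_field (\<lambda>j. - lam j) (\<lambda>_. ?f) (\<lambda>_. ?g) ?ft) i j"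
      by (cases i) (simp_all only: akns_field_1 akns_field_def[of lam mu n] lax_field_def a'_b'_c'_def fst_conv
          snd_conv idx.case, simp_all add: algebra_simps)
  qed
  with 1 2 show ?thesis by auto
qed

section \<open>Transfer to Euclidean space and polynomiality of the fields\<close>

instance idx :: finite
proof
  have "(UNIV :: idx set) = {I1, I2, I3}" using idx.exhaust by auto
  then show "finite (UNIV :: idx set)" by (metis finite.emptyI finite.insertI)
qed

text \<open>Identifies the phase space with a Euclidean space, the setting of
  \<open>commuting_flows\<close>; the boolean index separates P-entries (\<open>True\<close>) from
  Q-entries.\<close>

definition to_vec :: "'n::finite st \<Rightarrow> real ^ (bool \<times> idx \<times> 'n)" where
  "to_vec z = (\<chi> k. case k of (p, i, j) \<Rightarrow> if p then fst z i j else snd z i j)"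

definition of_vec :: "real ^ (bool \<times> idx \<times> 'n::finite) \<Rightarrow> 'n st" where
  "of_vec v = (\<lambda>i j. v $ (True, i, j), \<lambda>i j. v $ (False, i, j))"

lemma of_vec_to_vec [simp]: "of_vec (to_vec z) = (z :: 'n::finite st)"
  by (simp add: of_vec_def to_vec_def)

lemma to_vec_of_vec [simp]: "to_vec (of_vec v) = (v :: real ^ (bool \<times> idx \<times> 'n::finite))"
  by (auto simp: of_vec_def to_vec_def vec_eq_iff split: prod.splits)

lemma st_deriv_iff_to_vec:
  fixes \<zeta> :: "real \<Rightarrow> 'n::finite st"
  shows "st_deriv \<zeta> v s \<longleftrightarrow> ((\<lambda>s. to_vec (\<zeta> s)) has_vector_derivative to_vec v) (at s)"
proof
  assume d: "st_deriv \<zeta> v s"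
  have comp: "((\<lambda>s. to_vec (\<zeta> s) $ k) has_real_derivative to_vec v $ k) (at s)" for k
    using d by (cases k) (auto simp: to_vec_def st_deriv_def)
  have "((\<lambda>s. to_vec (\<zeta> s)) has_derivative (\<lambda>h. h *\<^sub>R to_vec v)) (at s)"
    by (subst has_derivative_componentwise_within)
      (use comp in \<open>auto simp: Basis_vec_def inner_axis has_field_derivative_def mult_commute_abs\<close>)
  then show "((\<lambda>s. to_vec (\<zeta> s)) has_vector_derivative to_vec v) (at s)"
    by (simp add: has_vector_derivative_def)
next
  assume d: "((\<lambda>s. to_vec (\<zeta> s)) has_vector_derivative to_vec v) (at s)"
  have "((\<lambda>s. to_vec (\<zeta> s) $ k) has_real_derivative to_vec v $ k) (at s)" for k
    unfolding has_real_derivative_iff_has_vector_derivative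
    by (rule bounded_linear.has_vector_derivative[OF bounded_linear_vec_nth d])
  from this[of "(True, _, _)"] this[of "(False, _, _)"] show "st_deriv \<zeta> v s"
    by (simp add: st_deriv_def to_vec_def)
qed

definition st_poly :: "('n::finite st \<Rightarrow> real) \<Rightarrow> bool" where
  "st_poly p \<longleftrightarrow> real_polynomial_function (\<lambda>v. p (of_vec v))"

lemma st_poly_intros:
  "st_poly (\<lambda>z. fst z i j)" "st_poly (\<lambda>z. snd z i j)" "st_poly (\<lambda>_. c)"
  "st_poly p \<Longrightarrow> st_poly q \<Longrightarrow> st_poly (\<lambda>z. p z + q z)"
  "st_poly p \<Longrightarrow> st_poly q \<Longrightarrow> st_poly (\<lambda>z. p z - q z)"
  "st_poly p \<Longrightarrow> st_poly q \<Longrightarrow> st_poly (\<lambda>z. p z * q z)"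
  "st_poly p \<Longrightarrow> st_poly (\<lambda>z. - p z)"
  "finite I \<Longrightarrow> (\<And>k. k \<in> I \<Longrightarrow> st_poly (P k)) \<Longrightarrow> st_poly (\<lambda>z. \<Sum>k\<in>I. P k z)"
  unfolding st_poly_def of_vec_def
  by (auto intro: real_polynomial_function.intros bounded_linear_vec_nth)

lemma st_poly_moments:
  "st_poly (ee lam mu k)" "st_poly (ff lam mu k)" "st_poly (gg lam mu k)"
  unfolding ee_def[abs_def] ff_def[abs_def] gg_def[abs_def] ipAB_def Pv_def Qv_def
  by (intro st_poly_intros finite)+

definition fps_poly :: "('n::finite st \<Rightarrow> real fps) \<Rightarrow> bool" where
  "fps_poly P \<longleftrightarrow> (\<forall>k. st_poly (\<lambda>z. fps_nth (P z) k))"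

lemma fps_poly_intros:
  "fps_poly (\<lambda>_. c)"
  "fps_poly P \<Longrightarrow> fps_poly Q \<Longrightarrow> fps_poly (\<lambda>z. P z + Q z)"
  "fps_poly P \<Longrightarrow> fps_poly Q \<Longrightarrow> fps_poly (\<lambda>z. P z - Q z)"
  "fps_poly P \<Longrightarrow> fps_poly Q \<Longrightarrow> fps_poly (\<lambda>z. P z * Q z)"
  unfolding fps_poly_def fps_mult_nth by (auto intro!: st_poly_intros)

lemma fps_poly_power: "fps_poly P \<Longrightarrow> fps_poly (\<lambda>z. P z ^ k)"
  by (induction k) (auto intro: fps_poly_intros)

lemma fps_poly_Abs_fps: "(\<And>k. st_poly (u k)) \<Longrightarrow> fps_poly (\<lambda>z. Abs_fps (\<lambda>k. u k z))"
  by (simp add: fps_poly_def)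

lemma fps_poly_gen: "fps_poly (genE lam mu)" "fps_poly (genF lam mu)" "fps_poly (genG lam mu)"
  unfolding genE_def[abs_def] genF_def[abs_def] genG_def[abs_def]
  by (intro fps_poly_intros fps_poly_Abs_fps st_poly_moments)+

text \<open>Although \<open>invroot\<close> stands for an inverse square root, each of its
  coefficients is a finite combination of coefficients of powers of \<open>casimir\<close>, hence
  polynomial in the state.\<close>

lemma fps_poly_invroot: "fps_poly (invroot lam mu)"
proof -
  have "fps_poly (casimir lam mu)"
    unfolding casimir_def[abs_def] by (intro fps_poly_intros fps_poly_gen)
  from fps_poly_power[OF this] show ?thesis
    unfolding fps_poly_def invroot_def fps_compose_nth by (auto intro!: st_poly_intros)
qed

lemma st_poly_trunc:
  "st_poly (\<lambda>z. trunc lam n (alpha lam mu z) j)" "st_poly (\<lambda>z. trunc lam n (beta lam mu z) j)"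
  "st_poly (\<lambda>z. trunc lam n (gamma lam mu z) j)"
proof -
  have "fps_poly (alpha lam mu)" "fps_poly (beta lam mu)" "fps_poly (gamma lam mu)"
    unfolding alpha_def[abs_def] beta_def[abs_def] gamma_def[abs_def]
    by (intro fps_poly_intros fps_poly_gen fps_poly_invroot)+
  then show "st_poly (\<lambda>z. trunc lam n (alpha lam mu z) j)" "st_poly (\<lambda>z. trunc lam n (beta lam mu z) j)"
    "st_poly (\<lambda>z. trunc lam n (gamma lam mu z) j)"
    unfolding trunc_def fps_poly_def by (auto intro!: st_poly_intros)
qed

definition vec_field :: "('n::finite \<Rightarrow> real) \<Rightarrow> ('n \<Rightarrow> real) \<Rightarrow> nat
    \<Rightarrow> real ^ (bool \<times> idx \<times> 'n) \<Rightarrow> real ^ (bool \<times> idx \<times> 'n)" where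
  "vec_field lam mu n v = to_vec (akns_field lam mu n (of_vec v))"

lemma polynomial_vec_field: "polynomial_function (vec_field lam mu n)"
proof -
  have "st_poly (\<lambda>z. fst (akns_field lam mu n z) i j)" "st_poly (\<lambda>z. snd (akns_field lam mu n z) i j)" for i j
    unfolding akns_field_def lax_field_def
    by (cases i; simp; intro st_poly_intros st_poly_trunc)+
  then have "real_polynomial_function (\<lambda>v. vec_field lam mu n v $ k)" for k
    by (cases k; cases "fst k") (simp_all add: vec_field_def to_vec_def st_poly_def)
  then show ?thesis
    unfolding polynomial_function_iff_Basis_inner
    by (auto simp: Basis_vec_def inner_axis)
qed

text \<open>The integration constants of the AKNS recursion are matched through the common quadratic
  relations \<open>akns_determinant\<close> and \<open>alpha_beta_gamma\<close>, which express the coefficient of index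
  \<open>Suc i\<close> of the diagonal entry by the previous ones.\<close>

lemma akns_coefficients_along_x_flow:
  fixes lam mu :: "'n::finite \<Rightarrow> real" and \<zeta> :: "real \<Rightarrow> 'n st"
  assumes akns: "akns_seq a b c" and X: "open X"
    and flow: "\<And>x. x \<in> X \<Longrightarrow> st_deriv \<zeta> (akns_field lam mu 1 (\<zeta> x)) x"
    and x: "x \<in> X"
  defines "Q \<equiv> \<lambda>x k. (deriv ^^ k) (\<lambda>y. sqrt 2 * ff lam mu 0 (\<zeta> y)) x"
    and "R \<equiv> \<lambda>x k. (deriv ^^ k) (\<lambda>y. sqrt 2 * gg lam mu 0 (\<zeta> y)) x"
  shows "a i (Q x) (R x) = fps_nth (alpha lam mu (\<zeta> x)) i"
    and "b i (Q x) (R x) = sqrt 2 * fps_nth (beta lam mu (\<zeta> x)) i"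
    and "c i (Q x) (R x) = sqrt 2 * fps_nth (gamma lam mu (\<zeta> x)) i"
proof -
  note akns' = akns[unfolded akns_seq_def]
  have poly: "dpoly (a i)" "dpoly (b i)" "dpoly (c i)" for i using akns' by auto
  have vflow: "((\<lambda>x. to_vec (\<zeta> x)) has_vector_derivative vec_field lam mu 1 (to_vec (\<zeta> x))) (at x)"
    if "x \<in> X" for x
    using flow[OF that] by (simp add: st_deriv_iff_to_vec vec_field_def)
  have jet: "((\<lambda>x. (deriv ^^ k) (\<lambda>y. p (\<zeta> y)) x) has_real_derivative (deriv ^^ Suc k) (\<lambda>y. p (\<zeta> y)) x) (at x)"
    if "st_poly p" "x \<in> X" for p k x
    using iterated_deriv_along_flow[OF that(1)[unfolded st_poly_def] polynomial_vec_field X vflow that(2)]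
    by simp
  have Q: "((\<lambda>x. Q x k) has_real_derivative Q x (Suc k)) (at x)"
    and R: "((\<lambda>x. R x k) has_real_derivative R x (Suc k)) (at x)" if "x \<in> X" for x k
    unfolding Q_def R_def by (intro jet st_poly_intros st_poly_moments that)+
  have Q0: "Q x 0 = sqrt 2 * ff lam mu 0 (\<zeta> x)" and R0: "R x 0 = sqrt 2 * gg lam mu 0 (\<zeta> x)" for x
    by (simp_all add: Q_def R_def)
  \<comment> \<open>On the jet of the actual solution, the formal total derivative is the true
    \<open>x\<close>-derivative.\<close>
  have D: "Dx f (Q x) (R x) = u'"
    if f: "dpoly f" and x: "x \<in> X" and u: "(u has_real_derivative u') (at x)"
      and eq: "\<And>x. x \<in> X \<Longrightarrow> f (Q x) (R x) = u x" for f x u u'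
  proof (rule DERIV_unique[OF _ u])
    have "((\<lambda>x. f (Q x) (R x)) has_real_derivative Dx f (Q x) (R x)) (at x)"
      using Q[OF x] R[OF x] by (intro Dx_chain[of f Q x R] f)
    then show "(u has_real_derivative Dx f (Q x) (R x)) (at x)"
      by (rule has_field_derivative_transform_within_open[OF _ X x]) (rule eq)
  qed
  have "\<forall>x\<in>X. a i (Q x) (R x) = fps_nth (alpha lam mu (\<zeta> x)) i \<and>
      b i (Q x) (R x) = sqrt 2 * fps_nth (beta lam mu (\<zeta> x)) i \<and>
      c i (Q x) (R x) = sqrt 2 * fps_nth (gamma lam mu (\<zeta> x)) i"
  proof (induction i rule: less_induct)
    case (less i)
    show ?case
    proof (cases i)
      case 0
      then show ?thesis using akns' by (simp add: low_coefficients)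
    next
      case (Suc m)
      have IH: "a l (Q x) (R x) = fps_nth (alpha lam mu (\<zeta> x)) l"
          "b l (Q x) (R x) = sqrt 2 * fps_nth (beta lam mu (\<zeta> x)) l"
          "c l (Q x) (R x) = sqrt 2 * fps_nth (gamma lam mu (\<zeta> x)) l" if "l \<le> m" "x \<in> X" for l x
        using less.IH[of l] that Suc by auto
      show ?thesis
      proof (intro ballI conjI)
        fix x assume x: "x \<in> X"
        note d = x_flow_coefficients[OF flow[OF x], of m]
        \<comment> \<open>The induction hypothesis on all of \<open>X\<close> may be differentiated;
          in the recursion the terms with \<open>alpha\<close> then cancel.\<close>
        have "Dx (b m) (Q x) (R x) = sqrt 2 * (- 2 * fps_nth (beta lam mu (\<zeta> x)) (Suc m)
            - 2 * ff lam mu 0 (\<zeta> x) * fps_nth (alpha lam mu (\<zeta> x)) m)"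
          by (rule D[OF poly(2) x DERIV_cmult[OF d(2)]]) (simp add: IH)
        moreover have "b (Suc m) (Q x) (R x) = - 1/2 * Dx (b m) (Q x) (R x) - Q x 0 * a m (Q x) (R x)"
          using akns' by metis
        ultimately show "b i (Q x) (R x) = sqrt 2 * fps_nth (beta lam mu (\<zeta> x)) i"
          using x by (simp add: Suc IH Q0 algebra_simps)
        have "Dx (c m) (Q x) (R x) = sqrt 2 * (2 * fps_nth (gamma lam mu (\<zeta> x)) (Suc m)
            + 2 * gg lam mu 0 (\<zeta> x) * fps_nth (alpha lam mu (\<zeta> x)) m)"
          by (rule D[OF poly(3) x DERIV_cmult[OF d(3)]]) (simp add: IH)
        moreover have "c (Suc m) (Q x) (R x) = 1/2 * Dx (c m) (Q x) (R x) - R x 0 * a m (Q x) (R x)"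
          using akns' by metis
        ultimately show "c i (Q x) (R x) = sqrt 2 * fps_nth (gamma lam mu (\<zeta> x)) i"
          using x by (simp add: Suc IH R0 algebra_simps)
        \<comment> \<open>In the quadratic relation only the two end terms contain index
          \<open>Suc m\<close>, because \<open>b\<close> and \<open>c\<close> start with 0. Their
          coefficient \<open>2 * a 0 = -2\<close> is nonzero, so the relation determines
          \<open>a (Suc m)\<close> without integration.\<close>
        have split: "(\<Sum>l=0..Suc m. u l * u (Suc m - l) + v l * w (Suc m - l))
            = 2 * u 0 * u (Suc m) + (\<Sum>l=1..m. u l * u (Suc m - l) + v l * w (Suc m - l))"
          if "v 0 = 0" "w 0 = 0" for u v w :: "nat \<Rightarrow> real"
        proof -
          have "{0..Suc m} = insert 0 (insert (Suc m) {1..m})" by auto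
          then show ?thesis using that by simp
        qed
        let ?al = "fps_nth (alpha lam mu (\<zeta> x))" and ?be = "\<lambda>l. sqrt 2 * fps_nth (beta lam mu (\<zeta> x)) l"
          and ?ga = "\<lambda>l. sqrt 2 * fps_nth (gamma lam mu (\<zeta> x)) l"
        have "fps_nth ((alpha lam mu (\<zeta> x))\<^sup>2 + 2 * (beta lam mu (\<zeta> x) * gamma lam mu (\<zeta> x))) (Suc m) = 0"
          using alpha_beta_gamma[of lam mu "\<zeta> x"] by (simp add: mult.assoc)
        moreover have "?be l * ?ga k = 2 * (fps_nth (beta lam mu (\<zeta> x)) l * fps_nth (gamma lam mu (\<zeta> x)) k)" for l k
        proof -
          have "?be l * ?ga k = (sqrt 2 * sqrt 2) * (fps_nth (beta lam mu (\<zeta> x)) l * fps_nth (gamma lam mu (\<zeta> x)) k)"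
            by (simp only: mult_ac)
          then show ?thesis by simp
        qed
        ultimately have "(\<Sum>l=0..Suc m. ?al l * ?al (Suc m - l) + ?be l * ?ga (Suc m - l)) = 0"
          by (simp only: fps_add_nth numeral_mult_fps_nth power2_eq_square)
            (simp only: fps_mult_nth sum_distrib_left sum.distrib)
        moreover have "(\<Sum>l=0..Suc m. a l (Q x) (R x) * a (Suc m - l) (Q x) (R x)
            + b l (Q x) (R x) * c (Suc m - l) (Q x) (R x)) = 0"
          by (rule akns_determinant[OF akns]) simp
        moreover have "(\<Sum>l=1..m. a l (Q x) (R x) * a (Suc m - l) (Q x) (R x)
            + b l (Q x) (R x) * c (Suc m - l) (Q x) (R x))
            = (\<Sum>l=1..m. ?al l * ?al (Suc m - l) + ?be l * ?ga (Suc m - l))"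
          by (intro sum.cong refl) (auto simp: IH x)
        ultimately have "2 * a 0 (Q x) (R x) * a (Suc m) (Q x) (R x) = 2 * ?al 0 * ?al (Suc m)"
          using split[of "\<lambda>l. b l (Q x) (R x)" "\<lambda>l. c l (Q x) (R x)" "\<lambda>l. a l (Q x) (R x)"]
            split[of ?be ?ga ?al] akns'
          by (simp add: low_coefficients)
        then show "a i (Q x) (R x) = ?al i"
          using akns' by (simp add: Suc low_coefficients)
      qed
    qed
  qed
  then show "a i (Q x) (R x) = fps_nth (alpha lam mu (\<zeta> x)) i"
    "b i (Q x) (R x) = sqrt 2 * fps_nth (beta lam mu (\<zeta> x)) i"
    "c i (Q x) (R x) = sqrt 2 * fps_nth (gamma lam mu (\<zeta> x)) i"
    using x by auto
qed

section \<open>The AKNS equation and commutation of the phase flows\<close>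

theorem theorem4p4:
  fixes lam mu :: "'n::finite \<Rightarrow> real" and n :: nat and z0 :: "'n st"
    and X T :: "real set" and Z W :: "real \<Rightarrow> real \<Rightarrow> 'n st"
    and a b c :: "nat \<Rightarrow> dpol"
  assumes distinct: "inj lam"
    and nonzero: "\<forall>j. mu j \<noteq> 0"
    and X: "open X" "connected X" "0 \<in> X"
    and T: "open T" "connected T" "0 \<in> T"
    \<comment> \<open>Z x t = g^x_H g^t_{H_n} z0\<close>
    and Z0: "Z 0 0 = z0"
    and Zt: "ham_sol mu (Hn lam mu n) (\<lambda>t. Z 0 t) T"
    and Zx: "\<forall>t\<in>T. ham_sol mu (Hx lam mu) (\<lambda>x. Z x t) X"
    \<comment> \<open>W x t = g^t_{H_n} g^x_H z0\<close>
    and W0: "W 0 0 = z0"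
    and Wx: "ham_sol mu (Hx lam mu) (\<lambda>x. W x 0) X"
    and Wt: "\<forall>x\<in>X. ham_sol mu (Hn lam mu n) (\<lambda>t. W x t) T"
    and akns: "akns_seq a b c"
  shows "(\<forall>x\<in>X. \<forall>t\<in>T.
            let q = (\<lambda>x t. sqrt 2 * ff lam mu 0 (Z x t));
                r = (\<lambda>x t. sqrt 2 * gg lam mu 0 (Z x t))
            in ((\<lambda>s. q x s) has_real_derivative
                   (-2 * b (Suc n) (xjet q x t) (xjet r x t))) (at t) \<and>
               ((\<lambda>s. r x s) has_real_derivative
                   (2 * c (Suc n) (xjet q x t) (xjet r x t))) (at t))
       \<and> (\<forall>x\<in>X. \<forall>t\<in>T. Z x t = W x t)"
proof -
  have Zt': "st_deriv (Z 0) (akns_field lam mu n (Z 0 t)) t" if "t \<in> T" for t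
    using ham_sol_Hn[OF Zt nonzero that] by simp
  have Zx': "st_deriv (\<lambda>x. Z x t) (akns_field lam mu 1 (Z x t)) x" if "x \<in> X" "t \<in> T" for x t
    using ham_sol_Hn[of mu lam 1 "\<lambda>x. Z x t" X x] Zx that nonzero by (simp add: Hx_eq_H1)
  have Wx': "st_deriv (\<lambda>x. W x 0) (akns_field lam mu 1 (W x 0)) x" if "x \<in> X" for x
    using ham_sol_Hn[of mu lam 1 "\<lambda>x. W x 0" X x] Wx that nonzero by (simp add: Hx_eq_H1)
  have Wt': "st_deriv (W x) (akns_field lam mu n (W x t)) t" if "x \<in> X" "t \<in> T" for x t
    using ham_sol_Hn[of mu lam n "W x" T t] Wt that nonzero by simp
  have ZW: "Z x t = W x t" if "x \<in> X" "t \<in> T" for x t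
  proof -
    have "to_vec (Z x t) = to_vec (W x t)"
    proof (rule commuting_flows[where f="vec_field lam mu 1" and g="vec_field lam mu n"
          and Z="\<lambda>x t. to_vec (Z x t)" and W="\<lambda>x t. to_vec (W x t)", OF _ _ _ X T(2,3)])
      fix v :: "real ^ (bool \<times> idx \<times> 'n)"
      \<comment> \<open>The bracket condition is tested along straight lines through
        \<open>v\<close> in the two field directions.\<close>
      have line: "st_deriv (\<lambda>s. of_vec (v + s *\<^sub>R to_vec w)) w 0" for w :: "'n st"
        unfolding st_deriv_iff_to_vec by (auto intro!: derivative_eq_intros)
      from akns_fields_commute[OF line _ line, of lam mu n "of_vec v"]
      obtain w where
        "st_deriv (\<lambda>s. akns_field lam mu 1 (of_vec (v + s *\<^sub>R vec_field lam mu n v))) w 0"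
        "st_deriv (\<lambda>s. akns_field lam mu n (of_vec (v + s *\<^sub>R vec_field lam mu 1 v))) w 0"
        unfolding vec_field_def by auto
      then show "\<exists>w. ((\<lambda>s. vec_field lam mu 1 (v + s *\<^sub>R vec_field lam mu n v)) has_vector_derivative w) (at 0) \<and>
          ((\<lambda>s. vec_field lam mu n (v + s *\<^sub>R vec_field lam mu 1 v)) has_vector_derivative w) (at 0)"
        unfolding st_deriv_iff_to_vec vec_field_def[symmetric] by blast
    qed (use that Zt' Zx' Wx' Wt' Z0 W0 in
        \<open>simp_all add: polynomial_vec_field st_deriv_iff_to_vec vec_field_def\<close>)
    then show ?thesis by (metis of_vec_to_vec)
  qed
  \<comment> \<open>Off the axis \<open>x = 0\<close> the \<open>t\<close>-equation is given for
    \<open>W\<close>; since \<open>T\<close> is open, \<open>ZW\<close> carries the derivative over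
    to \<open>Z\<close>.\<close>
  have "((\<lambda>s. sqrt 2 * ff lam mu 0 (Z x s)) has_real_derivative
      - 2 * (sqrt 2 * fps_nth (beta lam mu (Z x t)) (Suc n))) (at t) \<and>
    ((\<lambda>s. sqrt 2 * gg lam mu 0 (Z x s)) has_real_derivative
      2 * (sqrt 2 * fps_nth (gamma lam mu (Z x t)) (Suc n))) (at t)" if "x \<in> X" "t \<in> T" for x t
  proof
    have "((\<lambda>s. sqrt 2 * ff lam mu 0 (W x s)) has_real_derivative
        sqrt 2 * (- 2 * fps_nth (beta lam mu (W x t)) (Suc n))) (at t)"
      by (intro DERIV_cmult t_flow_moments Wt' that)
    then have "((\<lambda>s. sqrt 2 * ff lam mu 0 (Z x s)) has_real_derivative
        sqrt 2 * (- 2 * fps_nth (beta lam mu (W x t)) (Suc n))) (at t)"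
      by (rule has_field_derivative_transform_within_open[OF _ T(1) that(2)]) (simp add: ZW that)
    then show "((\<lambda>s. sqrt 2 * ff lam mu 0 (Z x s)) has_real_derivative
        - 2 * (sqrt 2 * fps_nth (beta lam mu (Z x t)) (Suc n))) (at t)"
      by (rule DERIV_cong) (simp add: ZW that)
    have "((\<lambda>s. sqrt 2 * gg lam mu 0 (W x s)) has_real_derivative
        sqrt 2 * (2 * fps_nth (gamma lam mu (W x t)) (Suc n))) (at t)"
      by (intro DERIV_cmult t_flow_moments Wt' that)
    then have "((\<lambda>s. sqrt 2 * gg lam mu 0 (Z x s)) has_real_derivative
        sqrt 2 * (2 * fps_nth (gamma lam mu (W x t)) (Suc n))) (at t)"
      by (rule has_field_derivative_transform_within_open[OF _ T(1) that(2)]) (simp add: ZW that)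
    then show "((\<lambda>s. sqrt 2 * gg lam mu 0 (Z x s)) has_real_derivative
        2 * (sqrt 2 * fps_nth (gamma lam mu (Z x t)) (Suc n))) (at t)"
      by (rule DERIV_cong) (simp add: ZW that)
  qed
  moreover have "xjet q x t = (\<lambda>k. (deriv ^^ k) (\<lambda>y. q y t) x)" for q x t
    by (simp add: xjet_def fun_eq_iff)
  ultimately show ?thesis
    using ZW akns_coefficients_along_x_flow(2,3)[OF akns X(1) Zx']
    unfolding Let_def by simp
qed

end
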